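(* Let $\mathbb{K}=\mathbb{R}$ or $\mathbb{K}=\mathbb{C}$, let $p,m\ge 1$ be integers, and let $f:\mathbb{R}_+^p\to\mathbb{K}$ and $g_i:(\mathbb{R}_+^{p})^m\to\mathbb{K}$, $i=1,\dots,m+1$, satisfy $$f(x_1+\cdots+x_{m+1})=\sum_{i=1}^{m+1}g_i(x_1,x_2,\dots,\widehat{x_i},\dots,x_{m+1})\quad\text{for all }x_1,\dots,x_{m+1}\in\mathbb{R}_+^p.$$ Then $f$ is the restriction to $\mathbb{R}_+^p$ of a unique polynomial function $F:\mathbb{R}^p\to\mathbb{K}$ of degree at most $m$. In particular, if $f$ is also bounded on a set $A\subseteq\mathbb{R}_+^p$ with positive Lebesgue measure, then there exists a unique ordinary polynomial $F$ of $p$ variables and total degree $\le m$ such that $F_{|\mathbb{R}_+^p}=f$, and the functions $g_i$ are also restrictions to $\mathbb{R}_+^{pm}$ of ordinary polynomials of total degree $\le m$ defined on $\mathbb{R}^{pm}$.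
   Context: $\mathbb{R}_+=\,]0,\infty[$ is the set of strictly positive real numbers, and $(\mathbb{R}_+^p)^m$ is identified with $\mathbb{R}_+^{pm}$. The notation $\widehat{x_i}$ means that the variable $x_i$ is omitted, so $g_i$ is a function of the remaining $m$ variables. For $h\in\mathbb{R}^p$ and $F:\mathbb{R}^p\to\mathbb{K}$, put $(\Delta_hF)(x)=F(x+h)-F(x)$; $F$ is a polynomial function (generalized polynomial) of degree at most $m$ if $\Delta_{h_1}\cdots\Delta_{h_{m+1}}F(x)=0$ for all $h_1,\dots,h_{m+1},x\in\mathbb{R}^p$. An ordinary polynomial of $p$ variables of total degree $\le m$ is a function $\sum_{i_1+\cdots+i_p\le m}a_{i_1,\dots,i_p}t_1^{i_1}\cdots t_p^{i_p}$ with coefficients in $\mathbb{K}$.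
   Formalization: The clause that the g_i are polynomials, false for m ≥ 2, is corrected: polynomials of degree ≤ m satisfying the same equation for f exist, and each given g_i differs from its polynomial by a sum of m functions, each omitting one of its variables (a constant if m = 1). *)

theory Defs
  imports "HOL-Analysis.Analysis"
begin

(* Scalars: the statement is made for an arbitrary type of class real_normed_field; up to
   isomorphism these are exactly the real and the complex numbers (Gelfand-Mazur). *)

definition pos_orthant :: "(real ^ 'p) set" where
  "pos_orthant = {x. \<forall>k. 0 < x $ k}"

(* Tuples (x_1,...,x_n) are functions on {1..n}; this maps (x_1,...,x_{n+1}) to the n-tuple
   without x_i.  It is extensional, so a function applied to it sees only the n entries. *)
definition omit :: "nat \<Rightarrow> nat \<Rightarrow> (nat \<Rightarrow> 'a) \<Rightarrow> (nat \<Rightarrow> 'a)" where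
  "omit n i x = (\<lambda>j\<in>{1..n}. if j < i then x j else x (Suc j))"

definition diff_op :: "'a::ab_group_add \<Rightarrow> ('a \<Rightarrow> 'b::ab_group_add) \<Rightarrow> 'a \<Rightarrow> 'b" where
  "diff_op h F = (\<lambda>x. F (x + h) - F x)"

definition polynomial_function_le :: "nat \<Rightarrow> (real ^ 'p \<Rightarrow> 'k::real_normed_field) \<Rightarrow> bool" where
  "polynomial_function_le m F \<longleftrightarrow>
     (\<forall>hs x. length hs = m + 1 \<longrightarrow> foldr diff_op hs F x = 0)"

definition multi_indices :: "'i set \<Rightarrow> nat \<Rightarrow> ('i \<Rightarrow> nat) set" where
  "multi_indices I d = {\<alpha> \<in> I \<rightarrow>\<^sub>E UNIV. (\<Sum>i\<in>I. \<alpha> i) \<le> d}"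

(* t i x is the i-th coordinate of x, for i in the finite set I of variables *)
definition polynomial_in_coords ::
    "'i set \<Rightarrow> ('i \<Rightarrow> 'a \<Rightarrow> real) \<Rightarrow> nat \<Rightarrow> ('a \<Rightarrow> 'k::real_normed_field) \<Rightarrow> bool" where
  "polynomial_in_coords I t d F \<longleftrightarrow>
     (\<exists>a. \<forall>x. F x = (\<Sum>\<alpha>\<in>multi_indices I d. a \<alpha> * of_real (\<Prod>i\<in>I. t i x ^ \<alpha> i)))"

definition ordinary_polynomial_le :: "nat \<Rightarrow> (real ^ 'p \<Rightarrow> 'k::real_normed_field) \<Rightarrow> bool" where
  "ordinary_polynomial_le d F \<longleftrightarrow> polynomial_in_coords UNIV (\<lambda>k x. x $ k) d F"

(* polynomials in the p n coordinates of n-tuples of vectors; entries outside {1..n} are ignored *)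
definition ordinary_polynomial_tuple_le ::
    "nat \<Rightarrow> nat \<Rightarrow> ((nat \<Rightarrow> real ^ 'p) \<Rightarrow> 'k::real_normed_field) \<Rightarrow> bool" where
  "ordinary_polynomial_tuple_le n d G \<longleftrightarrow>
     polynomial_in_coords ({1..n} \<times> UNIV) (\<lambda>(j, k) y. y j $ k) d G"

(* Pitfall: for m >= 2 the g_i themselves need not be polynomials, e.g. f = 0,
   g_1(x_2,x_3) = a(x_3), g_2(x_1,x_3) = - a(x_3), g_3 = 0 with a arbitrary.  Hence the claim about
   the g_i is made up to sums of functions of m - 1 of the vectors (constants if m = 1). *)

end

theory Submission
  imports Defs "HOL-Computational_Algebra.Polynomial"
begin

text \<open>
  Since \<open>g i\<close> does not see \<open>x i\<close>, taking the alternating sum of the functional equation over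
  all ways of replacing \<open>x i = a i\<close> by \<open>x i = a i + k i\<close> kills every term on the right. Hence
  \<open>\<Delta>\<^bsub>k 1\<^esub> \<dots> \<Delta>\<^bsub>k (m+1)\<^esub> f\<close> vanishes as long as its evaluation stays inside the orthant
  (\<open>foldr_diff_op_omit_eq_0\<close>). If \<open>\<Delta>\<^bsub>v\<^esub>\<^bsup>m+1\<^esup> F (x) = 0\<close> is to hold, then \<open>F x\<close> is
  forced by the values \<open>F (x + j v)\<close> with \<open>j \<ge> 1\<close>, and for large \<open>v\<close> these are values of \<open>f\<close>. The
  extension \<open>F\<close> is defined in this way, and the vanishing of the differences shows that the choice of
  \<open>v\<close> is immaterial and that \<open>F\<close> is a polynomial function (\<open>polynomial_extension\<close>).

  Everything else is deduced from one property that polynomial functions, ordinary polynomials and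
  their differences share: along every arithmetic progression \<open>x, x + h, x + 2 h, \<dots>\<close> they are given by
  a polynomial of degree at most \<open>m\<close> in the index (\<open>polynomial_on_lines\<close>). It yields uniqueness, since
  a polynomial with infinitely many zeros vanishes.

  For the second part, let \<open>F\<close> be bounded on a set \<open>A\<close> of positive measure. Near a point of density,
  every \<open>x\<close> is the start of a progression whose next \<open>m + 1\<close> terms lie in \<open>A\<close>
  (\<open>positive_measure_contains_progressions\<close>), so that Lagrange extrapolation bounds \<open>F\<close> on a ball.
  Newton's formula, applied to one coordinate after the other, provides an ordinary polynomial
  \<open>P\<close> that agrees with \<open>F\<close> at all points with natural coordinates
  (\<open>polynomial_function_on_lattice\<close>). The difference \<open>D = F - P\<close> vanishes at all
  rational points, because each of them is joined to infinitely many such lattice points by a progression.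
  Finally, a long progression that starts at a rational point \<open>q\<close> with \<open>x\<close> as its next term, and that
  stays in the ball, gives a polynomial in the index that vanishes at 0 and is bounded on a long interval. So its
  value \<open>D x\<close> at 1 is arbitrarily small. Thus \<open>D = 0\<close> on a ball, hence everywhere, and \<open>F = P\<close>
  (\<open>bounded_polynomial_function_is_ordinary\<close>).

  The polynomials \<open>G i\<close> come from \<open>\<Delta>\<^bsub>x 1\<^esub> \<dots> \<Delta>\<^bsub>x (m+1)\<^esub> F (0) = 0\<close>: it writes
  \<open>F (x 1 + \<dots> + x (m+1))\<close> as a combination of partial sums \<open>F (\<Sum>j\<in>S. x j)\<close> over proper subsets \<open>S\<close>,
  each of which misses some \<open>x i\<close>. The differences \<open>g i - G i\<close> satisfy the equation with zero left-hand side,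
  and freezing \<open>x i\<close> there expresses the \<open>i\<close>-th one through functions of \<open>m - 1\<close> vectors
  (\<open>annihilating_family_decomposes\<close>).
\<close>

section \<open>Iterated differences\<close>

lemma sum_Pow_insert:
  assumes "finite B" "i \<notin> B"
  shows "(\<Sum>S\<in>Pow (insert i B). \<phi> S) = (\<Sum>S\<in>Pow B. \<phi> S + \<phi> (insert i S))"
proof -
  have "inj_on (insert i) (Pow B)"
    using assms by (auto simp: inj_on_def)
  moreover have "Pow B \<inter> insert i ` Pow B = {}"
    using assms by auto
  ultimately show ?thesis
    using assms by (simp add: Pow_insert sum.union_disjoint sum.distrib sum.reindex)
qed

lemma diff_op_apply: "diff_op h F x = F (x + h) - F x"
  by (simp add: diff_op_def)

lemma foldr_diff_op_expand:
  fixes F :: "'a::ab_group_add \<Rightarrow> 'b::comm_ring_1"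
  shows "foldr diff_op (map k [1..<Suc n]) F x =
    (\<Sum>S\<in>Pow {1..n}. (-1) ^ (n + card S) * F (x + (\<Sum>i\<in>S. k i)))"
proof (induction n arbitrary: F)
  case 0
  then show ?case by simp
next
  case (Suc n)
  have fin: "finite S" and notin: "Suc n \<notin> S" if "S \<in> Pow {1..n}" for S
    using that by (auto intro: finite_subset)
  have "foldr diff_op (map k [1..<Suc (Suc n)]) F x
      = foldr diff_op (map k [1..<Suc n]) (diff_op (k (Suc n)) F) x"
    by simp
  also have "\<dots> = (\<Sum>S\<in>Pow {1..n}. (-1) ^ (n + card S) *
      (F (x + (\<Sum>i\<in>S. k i) + k (Suc n)) - F (x + (\<Sum>i\<in>S. k i))))"
    unfolding Suc diff_op_def ..
  also have "\<dots> = (\<Sum>S\<in>Pow {1..n}. (-1) ^ (Suc n + card S) * F (x + (\<Sum>i\<in>S. k i))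
      + (-1) ^ (Suc n + card (insert (Suc n) S)) * F (x + (\<Sum>i\<in>insert (Suc n) S. k i)))"
    by (intro sum.cong refl) (use fin notin in \<open>simp add: algebra_simps\<close>)
  also have "\<dots> = (\<Sum>S\<in>Pow (insert (Suc n) {1..n}).
      (-1) ^ (Suc n + card S) * F (x + (\<Sum>i\<in>S. k i)))"
    by (rule sum_Pow_insert [symmetric]) auto
  also have "insert (Suc n) {1..n} = {1..Suc n}"
    by auto
  finally show ?case .
qed

lemma diff_op_commute: "diff_op h (diff_op k F) = diff_op k (diff_op h F)"
  by (auto simp: diff_op_def fun_eq_iff algebra_simps)

lemma foldr_diff_op_commute: "foldr diff_op hs (diff_op k F) = diff_op k (foldr diff_op hs F)"
  by (induction hs) (simp_all add: diff_op_commute)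

lemma foldr_diff_op_swap:
  "foldr diff_op hs (foldr diff_op ks F) = foldr diff_op ks (foldr diff_op hs F)"
  by (induction hs) (simp_all add: foldr_diff_op_commute)

lemma foldr_diff_op_lincomb:
  fixes F G :: "'a::ab_group_add \<Rightarrow> 'b::comm_ring_1"
  shows "foldr diff_op hs (\<lambda>x. F x - c * G x)
       = (\<lambda>x. foldr diff_op hs F x - c * foldr diff_op hs G x)"
  by (induction hs) (simp_all add: diff_op_def fun_eq_iff algebra_simps)

text \<open>
  Only the values of a function near the base point enter its iterated difference; this
  permits replacing the extension, whose defining formula varies from point to point, by a
  single formula.
\<close>
lemma foldr_diff_op_cong_near:
  fixes F G :: "'a::real_normed_vector \<Rightarrow> 'b::ab_group_add"
  assumes "\<And>y. norm (y - x) \<le> sum_list (map norm ks) \<Longrightarrow> F y = G y"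
  shows "foldr diff_op ks F x = foldr diff_op ks G x"
  using assms
proof (induction ks arbitrary: x)
  case Nil
  then show ?case by simp
next
  case (Cons k ks)
  have "foldr diff_op ks F x = foldr diff_op ks G x"
    by (rule Cons.IH, rule Cons.prems) (simp add: add_increasing)
  moreover have "foldr diff_op ks F (x + k) = foldr diff_op ks G (x + k)"
  proof (rule Cons.IH, rule Cons.prems)
    fix y assume "norm (y - (x + k)) \<le> sum_list (map norm ks)"
    then show "norm (y - x) \<le> sum_list (map norm (k # ks))"
      using norm_triangle_ineq [of "y - (x + k)" k] by simp
  qed
  ultimately show ?case
    by (simp add: diff_op_apply [of k])
qed

text \<open>
  Writing \<open>\<Delta>\<^bsub>v\<^esub> = E - 1\<close> with the shift \<open>E\<close> by
  \<open>v\<close>, the only term of \<open>(E - 1)\<^bsup>n\<^esup>\<close> without a factor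
  \<open>E\<close> is \<open>(-1)\<^bsup>n\<^esup>\<close>.
\<close>
lemma foldr_diff_op_replicate_vanishing:
  fixes G :: "'a::real_vector \<Rightarrow> 'b::comm_ring_1"
  assumes "\<And>j. j \<ge> 1 \<Longrightarrow> G (x + of_nat j *\<^sub>R v) = 0"
  shows "foldr diff_op (replicate n v) G x = (-1) ^ n * G x"
  using assms
proof (induction n arbitrary: G)
  case 0
  then show ?case by simp
next
  case (Suc n)
  have van: "diff_op v G (x + of_nat j *\<^sub>R v) = 0" if "j \<ge> 1" for j
    using Suc.prems [of j] Suc.prems [of "Suc j"] that
    by (simp add: diff_op_def algebra_simps)
  have "foldr diff_op (replicate (Suc n) v) G x = foldr diff_op (replicate n v) (diff_op v G) x"
    by (simp only: replicate_Suc foldr.simps comp_apply foldr_diff_op_commute)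
  also have "\<dots> = (-1) ^ n * diff_op v G x"
    by (rule Suc.IH) (rule van)
  also have "diff_op v G x = - G x"
    using Suc.prems [of 1] by (simp add: diff_op_def)
  finally show ?case by simp
qed

text \<open>
  Replacing one increment \<open>h\<close> by \<open>h + w\<close> adds the iterated
  difference with increment \<open>w\<close> taken at \<open>x + h\<close>, which vanishes
  when \<open>x + h\<close> lies in \<open>P\<close>. Thus both \<open>h\<close> and
  \<open>k\<close> can be replaced by \<open>h + k\<close>, although \<open>x\<close> itself
  may lie outside \<open>P\<close>.
\<close>
lemma foldr_diff_op_increments:
  fixes f :: "'a::real_vector \<Rightarrow> 'b::ab_group_add"
  assumes sum: "\<And>a b. a \<in> P \<Longrightarrow> b \<in> P \<Longrightarrow> a + b \<in> P"
    and zero: "\<And>hs y. y \<in> P \<Longrightarrow> set hs \<subseteq> P \<Longrightarrow> length hs = n \<Longrightarrow> foldr diff_op hs f y = 0"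
    and hs: "set hs \<subseteq> {h \<in> P. x + h \<in> P}" "length hs = n"
    and ks: "set ks \<subseteq> {h \<in> P. x + h \<in> P}" "length ks = n"
  shows "foldr diff_op hs f x = foldr diff_op ks f x"
proof -
  have step: "foldr diff_op ((h + w) # us) f x = foldr diff_op (h # us) f x"
    if "h \<in> P" "x + h \<in> P" "w \<in> P" "set us \<subseteq> P" "Suc (length us) = n" for h w us
  proof -
    have "foldr diff_op (w # us) f (x + h) = 0"
      by (rule zero) (use that in auto)
    then show ?thesis
      by (simp add: diff_op_apply add.assoc)
  qed
  have swap: "foldr diff_op (h # us) f x = foldr diff_op (k # us) f x"
    if "h \<in> P" "x + h \<in> P" "k \<in> P" "x + k \<in> P" "set us \<subseteq> P" "Suc (length us) = n" for h k us
    using step [of h k us] step [of k h us] that by (simp add: add.commute)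
  have "foldr diff_op (us @ hs) f x = foldr diff_op (us @ ks) f x"
    if "length hs = length ks" "set hs \<subseteq> {h \<in> P. x + h \<in> P}" "set ks \<subseteq> {h \<in> P. x + h \<in> P}"
       "set us \<subseteq> P" "length us + length hs = n" for us hs ks
    using that
  proof (induction hs ks arbitrary: us rule: list_induct2)
    case Nil
    then show ?case by simp
  next
    case (Cons h hs k ks)
    have "foldr diff_op (us @ h # hs) f x = foldr diff_op (h # us @ hs) f x"
      by (simp add: foldr_diff_op_commute)
    also have "\<dots> = foldr diff_op (k # us @ hs) f x"
      by (rule swap) (use Cons.prems in auto)
    also have "\<dots> = foldr diff_op ((k # us) @ hs) f x" by simp
    also have "\<dots> = foldr diff_op ((k # us) @ ks) f x"
      by (rule Cons.IH) (use Cons.prems in auto)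
    also have "\<dots> = foldr diff_op (us @ k # ks) f x"
      by (simp add: foldr_diff_op_commute)
    finally show ?case .
  qed
  from this [of hs ks "[]"] hs ks show ?thesis by simp
qed

section \<open>Extension from the positive orthant\<close>

lemma pos_orthant_add: "a \<in> pos_orthant \<Longrightarrow> b \<in> pos_orthant \<Longrightarrow> a + b \<in> pos_orthant"
  by (simp add: pos_orthant_def add_pos_pos)

lemma pos_orthant_scaleR: "a \<in> pos_orthant \<Longrightarrow> c > 0 \<Longrightarrow> c *\<^sub>R a \<in> pos_orthant"
  by (simp add: pos_orthant_def)

lemma pos_orthant_shift:
  fixes y :: "real ^ 'p"
  assumes "norm y < c"
  shows "y + c *\<^sub>R 1 \<in> pos_orthant"
  unfolding pos_orthant_def
proof safe
  fix k
  have "\<bar>y $ k\<bar> < c"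
    using component_le_norm_cart [of y k] assms by linarith
  then show "0 < (y + c *\<^sub>R 1) $ k" by simp
qed

text \<open>
  The sets with and without \<open>i\<close> cancel in pairs.
\<close>
lemma sum_Pow_alternating_eq_0:
  fixes \<phi> :: "'a set \<Rightarrow> 'b::comm_ring_1"
  assumes "finite B" "i \<in> B" and "\<And>S. \<phi> (insert i S) = \<phi> (S - {i})"
  shows "(\<Sum>S\<in>Pow B. (-1) ^ (n + card S) * \<phi> S) = 0"
proof -
  have fin: "finite S" and notin: "i \<notin> S" if "S \<in> Pow (B - {i})" for S
    using that assms by (auto intro: finite_subset)
  have "(\<Sum>S\<in>Pow (insert i (B - {i})). (-1) ^ (n + card S) * \<phi> S) =
    (\<Sum>S\<in>Pow (B - {i}). (-1) ^ (n + card S) * \<phi> S + (-1) ^ (n + card (insert i S)) * \<phi> (insert i S))"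
    by (rule sum_Pow_insert) (use assms in auto)
  also have "\<dots> = 0"
    by (rule sum.neutral) (use fin notin assms(3) in simp)
  finally show ?thesis
    using assms(2) by (simp add: insert_absorb)
qed

text \<open>
  Expanding the difference as an alternating sum over the set \<open>S\<close> of those
  \<open>i\<close> at which \<open>a i\<close> is shifted to \<open>a i + k i\<close>, the
  contribution of \<open>g i\<close> does not depend on whether \<open>i \<in> S\<close>.
  Requiring \<open>a i + k i \<in> P\<close> admits increments in all directions, as the
  extension to the whole space needs.
\<close>
lemma foldr_diff_op_omit_eq_0:
  fixes f :: "real ^ 'p \<Rightarrow> 'k::real_normed_field"
  assumes eq: "\<And>x. (\<forall>i\<in>{1..m+1}. x i \<in> P) \<Longrightarrow>
           f (\<Sum>i=1..m+1. x i) = (\<Sum>i=1..m+1. g i (omit m i x))"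
    and a: "\<And>i. i \<in> {1..m+1} \<Longrightarrow> a i \<in> P"
    and ak: "\<And>i. i \<in> {1..m+1} \<Longrightarrow> a i + k i \<in> P"
  shows "foldr diff_op (map k [1..<Suc (m+1)]) f (\<Sum>i=1..m+1. a i) = 0"
proof -
  define b where "b S i = (if i \<in> S then a i + k i else a i)" for S i
  have b: "f ((\<Sum>i=1..m+1. a i) + (\<Sum>i\<in>S. k i)) = (\<Sum>i=1..m+1. g i (omit m i (b S)))"
    if "S \<in> Pow {1..m+1}" for S
  proof -
    have "(\<Sum>i=1..m+1. b S i) = (\<Sum>i=1..m+1. a i) + (\<Sum>i=1..m+1. if i \<in> S then k i else 0)"
      unfolding sum.distrib [symmetric] by (rule sum.cong) (auto simp: b_def)
    also have "(\<Sum>i=1..m+1. if i \<in> S then k i else 0) = (\<Sum>i\<in>S. k i)"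
      using that by (subst sum.inter_restrict [symmetric]) (auto simp: Int_absorb1)
    finally show ?thesis
      using eq [of "b S"] a ak by (simp add: b_def)
  qed
  have om: "omit m i (b (insert i S)) = omit m i (b (S - {i}))" for i S
    by (auto simp: omit_def b_def restrict_def fun_eq_iff)
  have "foldr diff_op (map k [1..<Suc (m+1)]) f (\<Sum>i=1..m+1. a i) =
    (\<Sum>S\<in>Pow {1..m+1}. (-1) ^ (m + 1 + card S) * (\<Sum>i=1..m+1. g i (omit m i (b S))))"
    unfolding foldr_diff_op_expand by (rule sum.cong) (simp_all only: b)
  also have "\<dots> = (\<Sum>i=1..m+1. \<Sum>S\<in>Pow {1..m+1}. (-1) ^ (m + 1 + card S) * g i (omit m i (b S)))"
    unfolding sum_distrib_left by (rule sum.swap)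
  also have "\<dots> = 0"
    by (rule sum.neutral, rule ballI, rule sum_Pow_alternating_eq_0)
      (auto intro: arg_cong [OF om])
  finally show ?thesis .
qed

text \<open>
  The term \<open>f x\<close> in the defining formula of \<open>F x\<close> cancels against
  the term of the iterated difference that belongs to the empty set of increments, so the junk
  values of \<open>f\<close> outside the orthant do not enter.
\<close>
lemma polynomial_extension:
  fixes f :: "real ^ 'p \<Rightarrow> 'k::real_normed_field"
  assumes eq: "\<And>x. (\<forall>i\<in>{1..m+1}. x i \<in> pos_orthant) \<Longrightarrow>
           f (\<Sum>i=1..m+1. x i) = (\<Sum>i=1..m+1. g i (omit m i x))"
  obtains F where "polynomial_function_le m F" "\<And>x. x \<in> pos_orthant \<Longrightarrow> F x = f x"
proof -
  define M where "M = m + 1"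
  have zero: "foldr diff_op ks f y = 0"
    if "length ks = M" and "y \<in> pos_orthant"
      and ks: "\<And>k. k \<in> set ks \<Longrightarrow> (1 / of_nat M) *\<^sub>R y + k \<in> pos_orthant" for ks y
  proof -
    define k where "k i = ks ! (i - 1)" for i
    have "ks = map k [1..<Suc (m+1)]"
      using that(1) by (intro nth_equalityI) (simp_all add: k_def M_def del: upt_Suc)
    moreover have "y = (\<Sum>i=1..m+1. (1 / of_nat M) *\<^sub>R y)"
      by (simp add: M_def sum_constant_scaleR del: sum_constant)
    moreover have "foldr diff_op (map k [1..<Suc (m+1)]) f (\<Sum>i=1..m+1. (1 / of_nat M) *\<^sub>R y) = 0"
      using that by (intro foldr_diff_op_omit_eq_0 [where P = pos_orthant and g = g] eq)
        (auto simp: M_def k_def intro!: pos_orthant_scaleR)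
    ultimately show ?thesis by simp
  qed
  define v :: "real \<Rightarrow> real ^ 'p" where "v c = c *\<^sub>R 1" for c
  define T where "T c x = foldr diff_op (replicate M (v c)) f x" for c x
  have v_pos: "v c \<in> pos_orthant" if "c > 0" for c
    using that by (simp add: v_def pos_orthant_def)
  have indep: "T c x = T d x" if "norm x < c" "norm x < d" for c d x
    unfolding T_def
  proof (rule foldr_diff_op_increments [where P = pos_orthant and n = M])
    have c: "c > 0" "d > 0" using that norm_ge_zero [of x] by linarith+
    show "set (replicate M (v c)) \<subseteq> {h \<in> pos_orthant. x + h \<in> pos_orthant}"
      "set (replicate M (v d)) \<subseteq> {h \<in> pos_orthant. x + h \<in> pos_orthant}"
      using c that v_pos pos_orthant_shift [of x] by (auto simp: v_def)
    show "foldr diff_op hs f y = 0" if "y \<in> pos_orthant" "set hs \<subseteq> pos_orthant" "length hs = M" for hs y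
      using that by (intro zero) (auto intro!: pos_orthant_add pos_orthant_scaleR simp: M_def)
  qed (auto intro: pos_orthant_add)
  define F where "F x = f x - (-1) ^ M * T (norm x + 1) x" for x
  have F: "F x = f x - (-1) ^ M * T c x" if "norm x < c" for x c
    unfolding F_def using indep [of x "norm x + 1" c] that by simp
  have Fpos: "F x = f x" if "x \<in> pos_orthant" for x
  proof -
    have "T (norm x + 1) x = 0"
      unfolding T_def by (rule zero)
        (use that in \<open>auto intro!: pos_orthant_add pos_orthant_scaleR v_pos add_nonneg_pos simp: M_def\<close>)
    then show ?thesis by (simp add: F_def)
  qed
  have "foldr diff_op ks F x = 0" if ks: "length ks = M" for ks x
  proof -
    define s where "s = sum_list (map norm ks)"
    define G where "G = foldr diff_op ks f"
    have s: "s \<ge> 0" "\<And>k. k \<in> set ks \<Longrightarrow> norm k \<le> s"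
      unfolding s_def by (auto intro!: sum_list_nonneg member_le_sum_list)
    \<comment> \<open>\<open>c\<close> is so large that the base point, split into \<open>M\<close> equal parts \<open>(x + j v) / M\<close>, leaves room for \<open>k\<close> in each.\<close>
    define c where "c = of_nat M * (norm x + s + 1)"
    have c: "norm x + s < c"
    proof -
      have "norm x + s + 1 \<le> c"
        unfolding c_def using mult_right_mono [of 1 "of_nat M" "norm x + s + 1"] s by (simp add: M_def)
      then show ?thesis by simp
    qed
    have "foldr diff_op ks F x = foldr diff_op ks (\<lambda>y. f y - (-1) ^ M * T c y) x"
    proof (rule foldr_diff_op_cong_near)
      fix y assume "norm (y - x) \<le> sum_list (map norm ks)"
      then have "norm y < c"
        using norm_triangle_ineq [of "y - x" x] c by (simp add: s_def)
      then show "F y = f y - (-1) ^ M * T c y" by (rule F)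
    qed
    also have "\<dots> = G x - (-1) ^ M * foldr diff_op ks (T c) x"
      by (simp add: foldr_diff_op_lincomb G_def)
    also have "foldr diff_op ks (T c) x = foldr diff_op (replicate M (v c)) G x"
      unfolding T_def G_def by (rule fun_cong [OF foldr_diff_op_swap])
    also have "\<dots> = (-1) ^ M * G x"
    proof (rule foldr_diff_op_replicate_vanishing)
      fix j :: nat assume j: "j \<ge> 1"
      have jc: "c \<le> of_nat j * c"
      proof -
        have "0 \<le> c" using c s(1) norm_ge_zero [of x] by linarith
        then show ?thesis using mult_right_mono [of 1 "of_nat j" c] j by simp
      qed
      show "G (x + of_nat j *\<^sub>R v c) = 0"
        unfolding G_def
      proof (rule zero [OF ks])
        show "x + of_nat j *\<^sub>R v c \<in> pos_orthant"
          unfolding v_def scaleR_scaleR by (rule pos_orthant_shift) (use jc c s in linarith)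
        fix k assume k: "k \<in> set ks"
        have "norm ((1 / of_nat M) *\<^sub>R x + k) \<le> norm ((1 / of_nat M) *\<^sub>R x) + norm k"
          by (rule norm_triangle_ineq)
        also have "\<dots> \<le> norm x + s"
          using s(2) [OF k] mult_left_le_one_le [of "norm x" "1 / of_nat M"]
          by (intro add_mono) (simp_all add: M_def)
        also have "\<dots> < (of_nat j * c) / of_nat M"
        proof -
          have "norm x + s < c / of_nat M" by (simp add: c_def M_def)
          also have "\<dots> \<le> (of_nat j * c) / of_nat M" using jc by (simp add: divide_right_mono)
          finally show ?thesis .
        qed
        finally have "((1 / of_nat M) *\<^sub>R x + k) + ((of_nat j * c) / of_nat M) *\<^sub>R 1 \<in> pos_orthant"
          by (rule pos_orthant_shift)
        then show "(1 / of_nat M) *\<^sub>R (x + of_nat j *\<^sub>R v c) + k \<in> pos_orthant"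
          by (simp add: v_def algebra_simps)
      qed
    qed
    finally show ?thesis
      by (simp flip: mult.assoc power_add add: mult_2 [symmetric])
  qed
  then have "polynomial_function_le m F"
    by (simp add: polynomial_function_le_def M_def)
  then show ?thesis using Fpos by (rule that)
qed

section \<open>Functions that are polynomial along arithmetic progressions\<close>

text \<open>
  The common weakening of both notions of polynomial that is closed under differences and
  suffices for all vanishing arguments.
\<close>
definition polynomial_on_lines :: "nat \<Rightarrow> ('a::real_vector \<Rightarrow> 'k::real_normed_field) \<Rightarrow> bool" where
  "polynomial_on_lines m D \<longleftrightarrow>
     (\<forall>x h. \<exists>Q. degree Q \<le> m \<and> (\<forall>n::nat. D (x + real n *\<^sub>R h) = poly Q (of_nat n)))"

lemma polynomial_on_linesE:
  assumes "polynomial_on_lines m D"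
  obtains Q where "degree Q \<le> m" "\<And>n::nat. D (x + real n *\<^sub>R h) = poly Q (of_nat n)"
  using assms unfolding polynomial_on_lines_def by blast

lemma polynomial_on_lines_diff:
  assumes "polynomial_on_lines m D" "polynomial_on_lines m E"
  shows "polynomial_on_lines m (\<lambda>x. D x - E x)"
  unfolding polynomial_on_lines_def
proof (intro allI)
  fix x h
  obtain Q where Q: "degree Q \<le> m" "\<And>n::nat. D (x + real n *\<^sub>R h) = poly Q (of_nat n)"
    using polynomial_on_linesE [OF assms(1), of x h] by blast
  obtain R where R: "degree R \<le> m" "\<And>n::nat. E (x + real n *\<^sub>R h) = poly R (of_nat n)"
    using polynomial_on_linesE [OF assms(2), of x h] by blast
  show "\<exists>Q. degree Q \<le> m \<and> (\<forall>n::nat. D (x + real n *\<^sub>R h) - E (x + real n *\<^sub>R h) = poly Q (of_nat n))"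
    by (intro exI [of _ "Q - R"]) (simp add: Q R degree_diff_le)
qed

lemma polynomial_on_lines_eq_0:
  assumes D: "polynomial_on_lines m D"
    and N: "infinite {n::nat. D (x + real n *\<^sub>R h) = 0}"
  shows "D (x + real n *\<^sub>R h) = 0"
proof -
  obtain Q where Q: "\<And>n::nat. D (x + real n *\<^sub>R h) = poly Q (of_nat n)"
    using polynomial_on_linesE [OF D, of x h] by blast
  have "infinite (of_nat ` {n::nat. D (x + real n *\<^sub>R h) = 0} :: 'b set)"
    using N by (simp add: finite_image_iff inj_on_def)
  moreover have "of_nat ` {n::nat. D (x + real n *\<^sub>R h) = 0} \<subseteq> {t. poly Q t = 0}"
    by (auto simp: Q)
  ultimately have "Q = 0"
    using poly_roots_finite finite_subset by blast
  then show ?thesis by (simp add: Q)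
qed

text \<open>
  From any point, a progression with direction \<open>(1, \<dots>, 1)\<close> eventually stays
  in the orthant.
\<close>
lemma polynomial_on_lines_vanishing_orthant:
  fixes D :: "real ^ 'p \<Rightarrow> 'k::real_normed_field"
  assumes D: "polynomial_on_lines m D" and zero: "\<And>x. x \<in> pos_orthant \<Longrightarrow> D x = 0"
  shows "D x = 0"
proof -
  obtain N :: nat where N: "norm x < real N" using reals_Archimedean2 by blast
  have "{N..} \<subseteq> {n. D (x + real n *\<^sub>R 1) = 0}"
    using N by (auto intro!: zero pos_orthant_shift)
  then have "D (x + real 0 *\<^sub>R 1) = 0"
    by (intro polynomial_on_lines_eq_0 [OF D]) (metis finite_subset infinite_Ici)
  then show ?thesis by simp
qed

section \<open>Newton's forward difference formula\<close>

lemma polynomial_function_le_diff_op: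
  "polynomial_function_le (Suc m) F \<Longrightarrow> polynomial_function_le m (diff_op h F)"
  unfolding polynomial_function_le_def
proof safe
  fix hs :: "(real ^ 'a) list" and x
  assume "\<forall>hs x. length hs = Suc m + 1 \<longrightarrow> foldr diff_op hs F x = 0" "length hs = m + 1"
  then have "foldr diff_op (hs @ [h]) F x = 0" by (metis Suc_eq_plus1 length_append_singleton)
  then show "foldr diff_op hs (diff_op h F) x = 0" by simp
qed

lemma polynomial_function_le_funpow_diff_op:
  "k \<le> m \<Longrightarrow> polynomial_function_le m F \<Longrightarrow> polynomial_function_le (m - k) ((diff_op h ^^ k) F)"
proof (induction k)
  case (Suc k)
  then show ?case
    using polynomial_function_le_diff_op [of "m - Suc k" "(diff_op h ^^ k) F" h] 
    by (simp add: Suc_diff_Suc)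
qed simp

text \<open>
  Induction on the degree: the increments of \<open>F\<close> along the progression are values
  of \<open>\<Delta>\<^bsub>h\<^esub> F\<close>, and they are summed with the hockey-stick
  identity.
\<close>
lemma Newton_forward_difference:
  fixes F :: "real ^ 'p \<Rightarrow> 'k::real_normed_field"
  assumes "polynomial_function_le m F"
  shows "F (x + real n *\<^sub>R h) = (\<Sum>k\<le>m. of_nat (n choose k) * (diff_op h ^^ k) F x)"
  using assms
proof (induction m arbitrary: F n)
  case 0
  then have "foldr diff_op [real n *\<^sub>R h] F x = 0"
    unfolding polynomial_function_le_def by (metis One_nat_def add_0 length_Cons list.size(3))
  then show ?case by (simp add: diff_op_def)
next
  case (Suc m)
  have "F (x + real n *\<^sub>R h) - F x = (\<Sum>i<n. diff_op h F (x + real i *\<^sub>R h))"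
  proof (induction n)
    case (Suc n)
    then show ?case by (simp add: diff_op_apply algebra_simps)
  qed simp
  also have "\<dots> = (\<Sum>i<n. \<Sum>k\<le>m. of_nat (i choose k) * (diff_op h ^^ k) (diff_op h F) x)"
    by (intro sum.cong refl Suc.IH polynomial_function_le_diff_op Suc.prems)
  also have "\<dots> = (\<Sum>k\<le>m. of_nat (\<Sum>i<n. i choose k) * (diff_op h ^^ Suc k) F x)"
    by (subst sum.swap) (simp only: sum_distrib_right of_nat_sum funpow_Suc_right comp_apply)
  also have "\<dots> = (\<Sum>k\<le>m. of_nat (n choose Suc k) * (diff_op h ^^ Suc k) F x)"
  proof -
    have "(\<Sum>i<n. i choose k) = n choose Suc k" for k
      by (induction n) simp_all
    then show ?thesis by simp
  qed
  finally show ?case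
    by (simp only: sum.atMost_Suc_shift) (simp add: algebra_simps)
qed

definition binomial_poly :: "nat \<Rightarrow> 'k::field_char_0 poly" where
  "binomial_poly k = smult (inverse (fact k)) (\<Prod>i<k. [:- of_nat i, 1:])"

lemma degree_binomial_poly: "degree (binomial_poly k :: 'k::field_char_0 poly) \<le> k"
proof -
  have "degree (\<Prod>i<k. [:- of_nat i, 1:] :: 'k poly) \<le> sum (degree \<circ> (\<lambda>i. [:- of_nat i, 1:] :: 'k poly)) {..<k}"
    by (rule degree_prod_sum_le) simp
  also have "\<dots> = k" by simp
  finally show ?thesis unfolding binomial_poly_def by (rule order_trans [OF degree_smult_le])
qed

lemma poly_binomial_poly:
  "poly (binomial_poly k) (of_nat n) = (of_nat (n choose k) :: 'k::field_char_0)"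
  by (simp add: binomial_poly_def poly_prod binomial_gbinomial gbinomial_prod_rev
      atLeast0LessThan divide_inverse mult.commute)

lemma polynomial_on_lines_polynomial_function:
  fixes F :: "real ^ 'p \<Rightarrow> 'k::real_normed_field"
  assumes "polynomial_function_le m F"
  shows "polynomial_on_lines m F"
  unfolding polynomial_on_lines_def
proof (intro allI)
  fix x h :: "real ^ 'p"
  let ?Q = "\<Sum>k\<le>m. smult ((diff_op h ^^ k) F x) (binomial_poly k)"
  have "degree ?Q \<le> m"
    by (intro degree_sum_le order_trans [OF degree_smult_le])
      (auto intro: order_trans [OF degree_binomial_poly])
  moreover have "F (x + real n *\<^sub>R h) = poly ?Q (of_nat n)" for n
    by (simp add: Newton_forward_difference [OF assms] poly_sum poly_binomial_poly mult.commute)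
  ultimately show "\<exists>Q. degree Q \<le> m \<and> (\<forall>n::nat. F (x + real n *\<^sub>R h) = poly Q (of_nat n))"
    by blast
qed

section \<open>Lagrange interpolation and growth of polynomials\<close>

definition lagrange_poly :: "'k::field set \<Rightarrow> 'k \<Rightarrow> 'k poly" where
  "lagrange_poly S s = (\<Prod>u\<in>S - {s}. smult (inverse (s - u)) [:- u, 1:])"

lemma poly_lagrange_poly:
  "finite S \<Longrightarrow> s \<in> S \<Longrightarrow> t \<in> S \<Longrightarrow> poly (lagrange_poly S s) t = (if t = s then 1 else 0)"
  by (auto simp: lagrange_poly_def poly_prod right_diff_distrib [symmetric] mult.commute [of s]
      intro!: prod.neutral left_inverse)

lemma degree_lagrange_poly:
  assumes "finite S" "s \<in> S"
  shows "degree (lagrange_poly S s) < card S"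
proof -
  have "degree (lagrange_poly S s) \<le> sum (degree \<circ> (\<lambda>u. smult (inverse (s - u)) [:- u, 1:])) (S - {s})"
    unfolding lagrange_poly_def using assms by (intro degree_prod_sum_le) simp
  also have "\<dots> \<le> (\<Sum>u\<in>S - {s}. 1)"
    by (intro sum_mono) simp
  also have "\<dots> < card S"
    using assms card_gt_0_iff [of S] by auto
  finally show ?thesis .
qed

lemma Lagrange_interpolation:
  fixes Q :: "'k::field poly"
  assumes "finite S" "degree Q < card S"
  shows "poly Q t = (\<Sum>s\<in>S. poly Q s * poly (lagrange_poly S s) t)"
proof -
  let ?L = "\<Sum>s\<in>S. smult (poly Q s) (lagrange_poly S s)"
  have "card S > 0" using assms by simp
  then have "degree ?L < card S"
    by (intro degree_sum_less) (auto intro: le_less_trans [OF degree_smult_le] degree_lagrange_poly assms)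
  then have "Q = ?L"
    using assms by (intro poly_eqI_degree [of S])
      (auto simp: poly_sum poly_lagrange_poly if_distrib sum.delta cong: if_cong)
  then have "poly Q t = poly ?L t" by simp
  then show ?thesis by (simp add: poly_sum)
qed

text \<open>
  Extrapolation to 0 from the nodes \<open>1, \<dots>, m + 1\<close> has coefficients that
  depend on \<open>m\<close> only, so one \<open>C\<close> serves all progressions.
\<close>
lemma polynomial_on_lines_bounded_extrapolation:
  fixes F :: "'a::real_vector \<Rightarrow> 'k::real_normed_field"
  assumes F: "polynomial_on_lines m F"
  shows "\<exists>C. \<forall>x h M. (\<forall>k\<in>{1..m+1}. norm (F (x + real k *\<^sub>R h)) \<le> M) \<longrightarrow> norm (F x) \<le> M * C"
proof (intro exI allI impI)
  let ?S = "of_nat ` {1..m+1} :: 'k set"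
  fix x h M
  assume M: "\<forall>k\<in>{1..m+1}. norm (F (x + real k *\<^sub>R h)) \<le> M"
  obtain Q where Q: "degree Q \<le> m" "\<And>n::nat. F (x + real n *\<^sub>R h) = poly Q (of_nat n)"
    using polynomial_on_linesE [OF F, of x h] by blast
  have "card ?S = m + 1" by (subst card_image) (auto simp: inj_on_def)
  then have "poly Q 0 = (\<Sum>s\<in>?S. poly Q s * poly (lagrange_poly ?S s) 0)"
    using Q by (intro Lagrange_interpolation) auto
  moreover have "F x = poly Q 0" using Q(2) [of 0] by simp
  ultimately have "norm (F x) \<le> (\<Sum>s\<in>?S. norm (poly Q s * poly (lagrange_poly ?S s) 0))"
    by (simp only: norm_sum)
  also have "\<dots> \<le> (\<Sum>s\<in>?S. M * norm (poly (lagrange_poly ?S s) 0))"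
    unfolding norm_mult by (intro sum_mono mult_right_mono) (use M Q(2) in auto)
  finally show "norm (F x) \<le> M * (\<Sum>s\<in>?S. norm (poly (lagrange_poly ?S s) 0))"
    by (simp add: sum_distrib_left)
qed

text \<open>
  After rescaling the variable by \<open>N\<close>, the polynomial is bounded by
  \<open>M\<close> at the fixed nodes \<open>0, \<dots>, m\<close> and hence is a combination
  of fixed basis polynomials with bounded coefficients. The node 0 contributes nothing, the
  other basis polynomials vanish at 0, and the point 1 becomes \<open>1 / N\<close>.
\<close>
lemma bounded_poly_small_near_root:
  fixes M e :: real
  assumes "e > 0"
  shows "\<exists>N>0. \<forall>Q :: 'k::real_normed_field poly. degree Q \<le> m \<longrightarrow> poly Q 0 = 0 \<longrightarrow>
       (\<forall>j\<le>m. norm (poly Q (of_nat (j * N))) \<le> M) \<longrightarrow> norm (poly Q 1) < e"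
proof -
  let ?S = "of_nat ` {..m} :: 'k set"
  let ?b = "\<lambda>t. \<Sum>s\<in>?S - {0}. M * norm (poly (lagrange_poly ?S s) t)"
  have "((\<lambda>N. ?b (inverse (of_nat N))) \<longlongrightarrow> (\<Sum>s\<in>?S - {0}. M * norm (poly (lagrange_poly ?S s) 0))) sequentially"
    by (intro tendsto_intros lim_inverse_n)
  also have "(\<Sum>s\<in>?S - {0}. M * norm (poly (lagrange_poly ?S s) 0)) = 0"
    by (intro sum.neutral) (auto simp: poly_lagrange_poly image_iff intro!: bexI [of _ 0])
  finally have "\<forall>\<^sub>F N in sequentially. ?b (inverse (of_nat N)) < e"
    using assms by (rule order_tendstoD)
  then have "\<forall>\<^sub>F N in sequentially. ?b (inverse (of_nat N)) < e \<and> N > 0"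
    using eventually_gt_at_top by (rule eventually_conj)
  then obtain N where N: "?b (inverse (of_nat N)) < e" "N > 0"
    by (blast dest: eventually_happens' [OF sequentially_bot])
  show ?thesis
  proof (intro exI [of _ N] conjI N(2) allI impI)
    fix Q :: "'k poly"
    assume Q: "degree Q \<le> m" "poly Q 0 = 0"
      and M: "\<forall>j\<le>m. norm (poly Q (of_nat (j * N))) \<le> M"
    define R where "R = pcompose Q [:0, of_nat N:]"
    have R: "poly R t = poly Q (of_nat N * t)" for t
      by (simp add: R_def poly_pcompose mult.commute)
    have "degree R \<le> m"
      unfolding R_def using Q(1) by (intro order_trans [OF degree_pcompose_le]) (simp add: mult_le_one)
    have "card ?S = m + 1" by (subst card_image) (auto simp: inj_on_def)
    define t :: 'k where "t = inverse (of_nat N)"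
    have "poly R t = (\<Sum>s\<in>?S. poly R s * poly (lagrange_poly ?S s) t)"
      using \<open>degree R \<le> m\<close> \<open>card ?S = m + 1\<close> by (intro Lagrange_interpolation) auto
    also have "\<dots> = (\<Sum>s\<in>?S - {0}. poly R s * poly (lagrange_poly ?S s) t)"
      by (rule sum.mono_neutral_right) (auto simp: R Q)
    finally have "norm (poly R t) \<le> (\<Sum>s\<in>?S - {0}. norm (poly R s * poly (lagrange_poly ?S s) t))"
      by (simp only: norm_sum)
    also have "\<dots> \<le> ?b t"
      unfolding norm_mult by (intro sum_mono mult_right_mono) (use M in \<open>auto simp: R mult.commute\<close>)
    also have "\<dots> < e" using N(1) by (simp add: t_def)
    finally have "norm (poly R (inverse (of_nat N))) < e" by (simp add: t_def)
    then show "norm (poly Q 1) < e"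
      using N(2) by (simp add: R)
  qed
qed

section \<open>Progressions in sets of positive measure\<close>

text \<open>
  If every ball had a share of at least \<open>e\<close> outside \<open>A\<close>, then a
  Vitali covering of \<open>A\<close> by disjoint balls inside an open set \<open>U
  \<supseteq> A\<close> would force \<open>U - A\<close> to have measure at least
  \<open>e\<close> times that of \<open>A\<close>; but \<open>U\<close> can be chosen close to
  \<open>A\<close>.
\<close>
lemma dense_cball:
  fixes A :: "'a::euclidean_space set"
  assumes A: "A \<in> sets lebesgue" "emeasure lebesgue A > 0" and e: "e > 0"
  obtains c r where "r > 0" "measure lebesgue (cball c r - A) < e * measure lebesgue (cball c r)"
proof (rule ccontr)
  assume "\<not> thesis"
  then have "\<not> (r > 0 \<and> measure lebesgue (cball c r - A) < e * measure lebesgue (cball c r))" for c r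
    using that by blast
  then have sparse: "e * measure lebesgue (cball c r) \<le> measure lebesgue (cball c r - A)" if "r > 0" for c r
    using that by (meson not_less)
  have Diff: "cball c r - A \<in> lmeasurable" for c :: 'a and r
    using A(1) by (simp add: fmeasurable_Diff)
  have sparse': "ennreal e * emeasure lebesgue (cball c r) \<le> emeasure lebesgue (cball c r - A)" if "r > 0" for c r
    using sparse [OF that, of c] e Diff [of c r]
    by (simp add: emeasure_eq_measure2 ennreal_leI flip: ennreal_mult)
  obtain d where d: "d > 0" "ennreal d \<le> ennreal e * emeasure lebesgue A"
  proof (cases "emeasure lebesgue A" rule: ennreal_cases)
    case (real a)
    then have "a > 0" using A(2) by (simp add: less_le)
    show ?thesis
      by (rule that [of "e * a"]) (use real e \<open>a > 0\<close> in \<open>simp_all add: ennreal_mult\<close>)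
  next
    case top
    show ?thesis
      by (rule that [of 1]) (use top e in \<open>simp_all add: ennreal_mult_top\<close>)
  qed
  obtain U where U: "open U" "A \<subseteq> U" "U - A \<in> lmeasurable" "emeasure lebesgue (U - A) < ennreal d"
    using sets_lebesgue_outer_open [OF A(1) d(1)] by blast
  define K where "K = {(c::'a, r::real). r > 0 \<and> cball c r \<subseteq> U}"
  obtain C where C: "countable C" "C \<subseteq> K"
    and pw: "pairwise (\<lambda>i j. disjnt (cball (fst i) (snd i)) (cball (fst j) (snd j))) C"
    and neg: "negligible (A - (\<Union>i\<in>C. cball (fst i) (snd i)))"
  proof (rule Vitali_covering_theorem_cballs [of K snd A fst])
    show "\<exists>i. i \<in> K \<and> x \<in> cball (fst i) (snd i) \<and> snd i < d" if "x \<in> A" "0 < d" for x d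
    proof -
      have "x \<in> U" using U(2) that(1) by blast
      then have "\<exists>s>0. cball x s \<subseteq> U" using U(1) unfolding open_contains_cball by (rule bspec [rotated])
      then obtain s where s: "s > 0" "cball x s \<subseteq> U" by blast
      have "cball x (min s (d / 2)) \<subseteq> cball x s" by (rule subset_cball) simp
      then have "(x, min s (d / 2)) \<in> K"
        using that(2) s by (simp add: K_def)
      then show ?thesis
        using that(2) s(1) by (intro exI [of _ "(x, min s (d / 2))"]) auto
    qed
    show "0 < snd i" if "i \<in> K" for i
      using that by (auto simp: K_def)
  qed (rule that)
  let ?B = "\<lambda>i. cball (fst i) (snd i)"
  have disj: "disjoint_family_on ?B C" "disjoint_family_on (\<lambda>i. ?B i - A) C"
    using pw unfolding disjoint_family_on_def pairwise_def disjnt_def by blast+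
  have meas: "(\<Union>i\<in>C. ?B i) \<in> sets lebesgue"
    using C(1) by (intro sets.countable_UN') auto
  have "emeasure lebesgue A \<le> emeasure lebesgue ((\<Union>i\<in>C. ?B i) \<union> (A - (\<Union>i\<in>C. ?B i)))"
    using meas A(1) by (intro emeasure_mono) auto
  also have "\<dots> = emeasure lebesgue (\<Union>i\<in>C. ?B i)"
    using meas neg by (intro emeasure_Un_null_set) (simp_all add: negligible_iff_null_sets)
  also have "\<dots> = (\<integral>\<^sup>+i. emeasure lebesgue (?B i) \<partial>count_space C)"
    using C(1) disj by (intro emeasure_UN_countable) auto
  finally have "ennreal e * emeasure lebesgue A \<le> ennreal e * (\<integral>\<^sup>+i. emeasure lebesgue (?B i) \<partial>count_space C)"
    by (rule mult_left_mono) simp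
  also have "\<dots> = (\<integral>\<^sup>+i. ennreal e * emeasure lebesgue (?B i) \<partial>count_space C)"
    by (simp add: nn_integral_cmult)
  also have "\<dots> \<le> (\<integral>\<^sup>+i. emeasure lebesgue (?B i - A) \<partial>count_space C)"
    using C(2) by (intro nn_integral_mono sparse') (auto simp: K_def)
  also have "\<dots> = emeasure lebesgue (\<Union>i\<in>C. ?B i - A)"
    using C(1) disj A(1) by (intro emeasure_UN_countable [symmetric]) auto
  also have "\<dots> \<le> emeasure lebesgue (U - A)"
  proof (rule emeasure_mono)
    show "(\<Union>i\<in>C. ?B i - A) \<subseteq> U - A"
      using C(2) unfolding K_def by fastforce
    show "U - A \<in> sets lebesgue" by (rule fmeasurableD) (rule U(3))
  qed
  also have "\<dots> < ennreal d" by (rule U)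
  finally show False using d(2) by simp
qed

text \<open>
  In a ball almost filled by \<open>A\<close>, the increments \<open>h\<close> with \<open>x +
  k h \<notin> A\<close> form, for each \<open>k\<close>, a contracted copy of a small set, so
  that \<open>n\<close> of these sets cannot cover all small \<open>h\<close>.
\<close>
lemma positive_measure_contains_progressions:
  fixes A :: "'a::euclidean_space set"
  assumes A: "A \<in> sets lebesgue" "emeasure lebesgue A > 0"
  obtains c r where "r > 0" "\<And>x. x \<in> ball c r \<Longrightarrow> \<exists>h. \<forall>k\<in>{1..n}. x + real k *\<^sub>R h \<in> A"
proof -
  define p where "p = DIM('a)"
  define q where "q = 1 / (2 * (real n + 1))"
  have q: "q > 0" by (simp add: q_def)
  \<comment> \<open>\<open>q\<close> keeps \<open>x + k h\<close> in the ball of radius \<open>s\<close>; \<open>e\<close> beats the \<open>n\<close> exceptional sets.\<close>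
  define e where "e = q ^ p / (real n + 1)"
  have "e > 0" using q by (simp add: e_def)
  then obtain c s where s: "s > 0"
    and dens: "measure lebesgue (cball c s - A) < e * measure lebesgue (cball c s)"
    using dense_cball [OF A] by metis
  define B where "B = cball c s - A"
  have B: "B \<in> lmeasurable" using A(1) by (simp add: B_def fmeasurable_Diff)
  show ?thesis
  proof (rule that [of "s / 2" c])
    show "s / 2 > 0" using s by simp
    fix x assume "x \<in> ball c (s / 2)"
    then have x: "dist c x < s / 2" by simp
    show "\<exists>h. \<forall>k\<in>{1..n}. x + real k *\<^sub>R h \<in> A"
    proof (rule ccontr)
      assume "\<not> ?thesis"
      then have bad: "\<exists>k\<in>{1..n}. x + real k *\<^sub>R h \<notin> A" for h by blast
      define T where "T k = (\<lambda>y. (1 / real k) *\<^sub>R y + (- (1 / real k) *\<^sub>R x)) ` B" for k :: nat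
      define H :: "'a set" where "H = cball 0 (q * s)"
      have T: "T k \<in> lmeasurable" for k
      proof (cases "k = 0")
        case True
        then have "T k \<subseteq> {0}" by (auto simp: T_def)
        then show ?thesis
          by (intro negligible_imp_measurable negligible_finite) (auto intro: finite_subset)
      next
        case False
        have "T k = (*\<^sub>R) (real k) -` ((\<lambda>y. - x + y) ` B)"
        proof (intro equalityI subsetI)
          fix h assume "h \<in> T k"
          then obtain y where "y \<in> B" "h = (1 / real k) *\<^sub>R y + (- (1 / real k) *\<^sub>R x)"
            by (auto simp: T_def)
          with False show "h \<in> (*\<^sub>R) (real k) -` ((\<lambda>y. - x + y) ` B)"
            by (intro vimageI2 image_eqI [of _ _ y]) (simp_all add: scaleR_right_diff_distrib)
        next
          fix h assume "h \<in> (*\<^sub>R) (real k) -` ((\<lambda>y. - x + y) ` B)"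
          then obtain y where "real k *\<^sub>R h = - x + y" "y \<in> B" by blast
          moreover from this(1) have "h = (1 / real k) *\<^sub>R (- x + y)"
            using False by (metis divide_self_if mult.commute of_nat_eq_0_iff scaleR_one scaleR_scaleR times_divide_eq_left mult_1)
          ultimately show "h \<in> T k"
            by (auto simp: T_def algebra_simps intro!: image_eqI [of _ _ y])
        qed
        moreover have "(*\<^sub>R) (real k) -` ((\<lambda>y. - x + y) ` B) \<in> sets lebesgue"
          using measurable_sets [OF lebesgue_measurable_scaling, of "(\<lambda>y. - x + y) ` B" "real k"]
            measurable_translation [OF B, of "- x"] by (simp add: fmeasurableD)
        moreover have "emeasure lebesgue (T k) < \<infinity>"
          unfolding T_def emeasure_lebesgue_affine
          using fmeasurableD2 [OF B] by (simp add: ennreal_mult_less_top top.not_eq_extremum less_top)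
        ultimately show ?thesis by (intro fmeasurableI) simp_all
      qed
      have "H \<subseteq> (\<Union>k\<in>{1..n}. T k)"
      proof
        fix h assume "h \<in> H"
        then have h: "norm h \<le> q * s" by (simp add: H_def)
        obtain k where k: "k \<in> {1..n}" "x + real k *\<^sub>R h \<notin> A" using bad by blast
        have "real k * norm h \<le> (real n + 1) * (q * s)"
          using k h by (intro mult_mono) auto
        also have "\<dots> = s / 2" by (simp add: q_def field_simps)
        finally have "norm (real k *\<^sub>R h) \<le> s / 2" by simp
        then have "dist c (x + real k *\<^sub>R h) \<le> s"
          using x norm_triangle_ineq4 [of "c - x" "real k *\<^sub>R h"] by (simp add: dist_norm algebra_simps)
        then have "x + real k *\<^sub>R h \<in> B" using k by (simp add: B_def)
        moreover have "h = (1 / real k) *\<^sub>R (x + real k *\<^sub>R h) + (- (1 / real k) *\<^sub>R x)"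
          using k by (simp add: algebra_simps)
        ultimately show "h \<in> (\<Union>k\<in>{1..n}. T k)" using k(1) unfolding T_def by blast
      qed
      then have "measure lebesgue H \<le> measure lebesgue (\<Union>k\<in>{1..n}. T k)"
        using T by (intro measure_mono_fmeasurable fmeasurable.finite_UN) (auto simp: H_def)
      also have "\<dots> \<le> (\<Sum>k\<in>{1..n}. measure lebesgue (T k))"
        using T by (intro measure_UNION_le) auto
      also have "\<dots> \<le> (\<Sum>k\<in>{1..n}. measure lebesgue B)"
      proof (rule sum_mono)
        fix k assume "k \<in> {1..n}"
        have "measure lebesgue (T k) = \<bar>1 / real k\<bar> ^ p * measure lebesgue B"
          unfolding T_def p_def by (rule measure_lebesgue_affine)
        also have "\<dots> \<le> 1 * measure lebesgue B"
          using \<open>k \<in> {1..n}\<close> by (intro mult_right_mono power_le_one) auto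
        finally show "measure lebesgue (T k) \<le> measure lebesgue B" by simp
      qed
      also have "\<dots> \<le> (real n + 1) * measure lebesgue B"
        by (simp add: mult_right_mono)
      also have "\<dots> < (real n + 1) * (e * measure lebesgue (cball c s))"
        using dens by (intro mult_strict_left_mono) (auto simp: B_def)
      also have "\<dots> = q ^ p * measure lebesgue (cball c s)" by (simp add: e_def)
      also have "\<dots> = measure lebesgue H"
        using q s by (simp add: H_def content_cball p_def power_mult_distrib)
      finally show False by simp
    qed
  qed
qed

section \<open>Polynomials in finitely many coordinates\<close>

definition monomial :: "'i set \<Rightarrow> ('i \<Rightarrow> 'a \<Rightarrow> real) \<Rightarrow> ('i \<Rightarrow> nat) \<Rightarrow> 'a \<Rightarrow> real" where
  "monomial I t \<alpha> x = (\<Prod>i\<in>I. t i x ^ \<alpha> i)"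

lemma polynomial_in_coords_alt:
  "polynomial_in_coords I t d F \<longleftrightarrow>
     (\<exists>a. \<forall>x. F x = (\<Sum>\<alpha>\<in>multi_indices I d. a \<alpha> * of_real (monomial I t \<alpha> x)))"
  by (simp add: polynomial_in_coords_def monomial_def)

context
  fixes I :: "'i set" and t :: "'i \<Rightarrow> 'a \<Rightarrow> real"
  assumes I: "finite I"
begin

lemma finite_multi_indices: "finite (multi_indices I d)"
proof (rule finite_subset)
  show "multi_indices I d \<subseteq> I \<rightarrow>\<^sub>E {..d}"
  proof (rule subsetI, rule PiE_I)
    fix \<alpha> i assume \<alpha>: "\<alpha> \<in> multi_indices I d" and "i \<in> I"
    have "\<alpha> i \<le> (\<Sum>i\<in>I. \<alpha> i)"
      using I \<open>i \<in> I\<close> by (intro member_le_sum) auto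
    with \<alpha> show "\<alpha> i \<in> {..d}" by (auto simp: multi_indices_def)
  qed (auto simp: multi_indices_def PiE_def extensional_def)
  show "finite (I \<rightarrow>\<^sub>E {..d})" using I by (intro finite_PiE) auto
qed

text \<open>
  The functions in question form the linear span of the monomials; together with closure under
  sums this is all that products need.
\<close>
lemma polynomial_in_coords_monomial:
  assumes "\<alpha> \<in> multi_indices I d"
  shows "polynomial_in_coords I t d (\<lambda>x. c * of_real (monomial I t \<alpha> x))"
  unfolding polynomial_in_coords_alt
  by (rule exI [of _ "\<lambda>\<beta>. if \<beta> = \<alpha> then c else 0"])
    (use assms finite_multi_indices in \<open>simp add: if_distrib [of "\<lambda>u. u * _"] sum.delta cong: if_cong\<close>)

lemma polynomial_in_coords_add:
  assumes "polynomial_in_coords I t d F" "polynomial_in_coords I t d G"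
  shows "polynomial_in_coords I t d (\<lambda>x. F x + G x)"
proof -
  obtain a b where "\<And>x. F x = (\<Sum>\<alpha>\<in>multi_indices I d. a \<alpha> * of_real (monomial I t \<alpha> x))"
    "\<And>x. G x = (\<Sum>\<alpha>\<in>multi_indices I d. b \<alpha> * of_real (monomial I t \<alpha> x))"
    using assms unfolding polynomial_in_coords_alt by metis
  then show ?thesis
    unfolding polynomial_in_coords_alt
    by (intro exI [of _ "\<lambda>\<alpha>. a \<alpha> + b \<alpha>"]) (simp add: sum.distrib distrib_right)
qed

lemma polynomial_in_coords_const: "polynomial_in_coords I t d (\<lambda>x. c)"
proof -
  have "(\<lambda>i\<in>I. 0) \<in> multi_indices I d" by (simp add: multi_indices_def)
  then have "polynomial_in_coords I t d (\<lambda>x. c * of_real (monomial I t (\<lambda>i\<in>I. 0) x))"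
    by (rule polynomial_in_coords_monomial)
  then show ?thesis by (simp add: monomial_def)
qed

lemma polynomial_in_coords_sum:
  assumes "\<And>s. s \<in> S \<Longrightarrow> polynomial_in_coords I t d (F s)"
  shows "polynomial_in_coords I t d (\<lambda>x. \<Sum>s\<in>S. F s x)"
  using assms
  by (induction S rule: infinite_finite_induct)
    (auto intro: polynomial_in_coords_const polynomial_in_coords_add)

lemma monomial_mult:
  "monomial I t \<alpha> x * monomial I t \<beta> x = monomial I t (\<lambda>i\<in>I. \<alpha> i + \<beta> i) x"
  by (simp add: monomial_def prod.distrib power_add)

lemma polynomial_in_coords_mult:
  assumes F: "polynomial_in_coords I t d F" and G: "polynomial_in_coords I t e G"
  shows "polynomial_in_coords I t (d + e) (\<lambda>x. F x * G x)"
proof -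
  obtain a b where ab: "\<And>x. F x = (\<Sum>\<alpha>\<in>multi_indices I d. a \<alpha> * of_real (monomial I t \<alpha> x))"
    "\<And>x. G x = (\<Sum>\<alpha>\<in>multi_indices I e. b \<alpha> * of_real (monomial I t \<alpha> x))"
    using assms unfolding polynomial_in_coords_alt by metis
  have "F x * G x = (\<Sum>\<alpha>\<in>multi_indices I d. \<Sum>\<beta>\<in>multi_indices I e.
      (a \<alpha> * b \<beta>) * of_real (monomial I t (\<lambda>i\<in>I. \<alpha> i + \<beta> i) x))" for x
    by (simp add: ab sum_product flip: monomial_mult) (simp add: mult_ac)
  moreover have "(\<lambda>i\<in>I. \<alpha> i + \<beta> i) \<in> multi_indices I (d + e)"
    if "\<alpha> \<in> multi_indices I d" "\<beta> \<in> multi_indices I e" for \<alpha> \<beta>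
    using that by (auto simp: multi_indices_def sum.distrib)
  ultimately show ?thesis
    by (simp only:) (intro polynomial_in_coords_sum polynomial_in_coords_monomial)
qed

lemma polynomial_in_coords_mono:
  assumes F: "polynomial_in_coords I t d F" and "d \<le> e"
  shows "polynomial_in_coords I t e F"
  using polynomial_in_coords_mult [OF F polynomial_in_coords_const [of "e - d" 1]] assms(2) by simp

lemma polynomial_in_coords_prod:
  assumes "\<And>s. s \<in> S \<Longrightarrow> polynomial_in_coords I t (d s) (F s)"
  shows "polynomial_in_coords I t (\<Sum>s\<in>S. d s) (\<lambda>x. \<Prod>s\<in>S. F s x)"
  using assms
  by (induction S rule: infinite_finite_induct)
    (auto intro: polynomial_in_coords_const polynomial_in_coords_mult)

lemma polynomial_in_coords_power:
  assumes "polynomial_in_coords I t d F"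
  shows "polynomial_in_coords I t (n * d) (\<lambda>x. F x ^ n)"
  using polynomial_in_coords_prod [of "{..<n}" "\<lambda>_. d" "\<lambda>_. F"] assms by simp

lemma polynomial_in_coords_coord:
  assumes "i \<in> I"
  shows "polynomial_in_coords I t 1 (\<lambda>x. of_real (t i x))"
proof -
  let ?\<alpha> = "\<lambda>j\<in>I. if j = i then 1 else 0 :: nat"
  have "?\<alpha> \<in> multi_indices I 1"
    using I assms by (auto simp: multi_indices_def)
  then have "polynomial_in_coords I t 1 (\<lambda>x. 1 * of_real (monomial I t ?\<alpha> x))"
    by (rule polynomial_in_coords_monomial)
  moreover have "monomial I t ?\<alpha> x = t i x" for x
  proof -
    have "monomial I t ?\<alpha> x = (\<Prod>j\<in>I. if j = i then t j x else 1)"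
      unfolding monomial_def by (rule prod.cong) auto
    then show ?thesis using I assms by simp
  qed
  ultimately show ?thesis by simp
qed

lemma polynomial_in_coords_poly:
  assumes "i \<in> I" "degree Q \<le> d"
  shows "polynomial_in_coords I t d (\<lambda>x. poly Q (of_real (t i x)))"
proof -
  have "polynomial_in_coords I t d (\<lambda>x. coeff Q j * of_real (t i x) ^ j)" if "j \<le> degree Q" for j
    using polynomial_in_coords_mult [OF polynomial_in_coords_const [of 0 "coeff Q j"]
        polynomial_in_coords_power [OF polynomial_in_coords_coord [OF assms(1)], of j]] that assms(2)
    by (auto intro: polynomial_in_coords_mono)
  then show ?thesis
    unfolding poly_altdef by (intro polynomial_in_coords_sum) auto
qed

end

text \<open>
  Substituting functions of degree 1 does not raise the degree.
\<close>
lemma ordinary_polynomial_compose: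
  fixes F :: "real ^ 'p \<Rightarrow> 'k::real_normed_field" and u :: "'a \<Rightarrow> real ^ 'p"
  assumes F: "ordinary_polynomial_le d F" and I: "finite I"
    and u: "\<And>k. polynomial_in_coords I t 1 (\<lambda>y. of_real (u y $ k) :: 'k)"
  shows "polynomial_in_coords I t d (\<lambda>y. F (u y))"
proof -
  obtain a where a: "\<And>x. F x = (\<Sum>\<alpha>\<in>multi_indices UNIV d. a \<alpha> * of_real (\<Prod>k\<in>UNIV. (x $ k) ^ \<alpha> k))"
    using F unfolding ordinary_polynomial_le_def polynomial_in_coords_def by blast
  have "polynomial_in_coords I t d (\<lambda>y. a \<alpha> * (\<Prod>k\<in>UNIV. of_real (u y $ k) ^ \<alpha> k))"
    if "\<alpha> \<in> multi_indices UNIV d" for \<alpha>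
  proof -
    have "polynomial_in_coords I t (0 + (\<Sum>k\<in>UNIV. \<alpha> k * 1))
        (\<lambda>y. a \<alpha> * (\<Prod>k\<in>UNIV. of_real (u y $ k) ^ \<alpha> k))"
      by (intro polynomial_in_coords_mult polynomial_in_coords_const polynomial_in_coords_prod
          polynomial_in_coords_power I u)
    then show ?thesis
      by (rule polynomial_in_coords_mono [OF I]) (use that in \<open>simp add: multi_indices_def\<close>)
  qed
  then show ?thesis
    unfolding a of_real_prod of_real_power by (intro polynomial_in_coords_sum I)
qed

section \<open>Ordinary polynomials and lattice points\<close>

lemma polynomial_on_lines_ordinary_polynomial:
  fixes F :: "real ^ 'p \<Rightarrow> 'k::real_normed_field"
  assumes "ordinary_polynomial_le d F"
  shows "polynomial_on_lines d F"
  unfolding polynomial_on_lines_def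
proof (intro allI)
  fix x h :: "real ^ 'p"
  obtain a where a: "\<And>x. F x = (\<Sum>\<alpha>\<in>multi_indices UNIV d. a \<alpha> * of_real (\<Prod>k\<in>UNIV. (x $ k) ^ \<alpha> k))"
    using assms unfolding ordinary_polynomial_le_def polynomial_in_coords_def by blast
  define q where "q k = [:of_real (x $ k), of_real (h $ k) :: 'k:]" for k
  define Q where "Q = (\<Sum>\<alpha>\<in>multi_indices UNIV d. smult (a \<alpha>) (\<Prod>k\<in>UNIV. q k ^ \<alpha> k))"
  have "degree Q \<le> d"
    unfolding Q_def
  proof (intro degree_sum_le finite_multi_indices order_trans [OF degree_smult_le])
    fix \<alpha> :: "'p \<Rightarrow> nat" assume \<alpha>: "\<alpha> \<in> multi_indices UNIV d"
    have "degree (\<Prod>k\<in>UNIV. q k ^ \<alpha> k) \<le> (\<Sum>k\<in>UNIV. (degree \<circ> (\<lambda>k. q k ^ \<alpha> k)) k)"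
      by (rule degree_prod_sum_le) simp
    also have "\<dots> \<le> (\<Sum>k\<in>UNIV. \<alpha> k)"
    proof (rule sum_mono)
      fix k
      have "degree (q k ^ \<alpha> k) \<le> degree (q k) * \<alpha> k" by (rule degree_power_le)
      also have "\<dots> \<le> 1 * \<alpha> k" by (rule mult_right_mono) (simp_all add: q_def)
      finally show "(degree \<circ> (\<lambda>k. q k ^ \<alpha> k)) k \<le> \<alpha> k" by simp
    qed
    also have "\<dots> \<le> d" using \<alpha> by (simp add: multi_indices_def)
    finally show "degree (\<Prod>k\<in>UNIV. q k ^ \<alpha> k) \<le> d" .
  qed simp
  moreover have "F (x + real n *\<^sub>R h) = poly Q (of_nat n)" for n
    by (simp add: a Q_def q_def poly_sum poly_prod)
  ultimately show "\<exists>Q. degree Q \<le> d \<and> (\<forall>n::nat. F (x + real n *\<^sub>R h) = poly Q (of_nat n))"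
    by blast
qed

lemma continuous_on_ordinary_polynomial:
  fixes F :: "real ^ 'p \<Rightarrow> 'k::real_normed_field"
  assumes "ordinary_polynomial_le d F"
  shows "continuous_on S F"
proof -
  obtain a where a: "F = (\<lambda>x. \<Sum>\<alpha>\<in>multi_indices UNIV d. a \<alpha> * of_real (\<Prod>k\<in>UNIV. (x $ k) ^ \<alpha> k))"
    using assms unfolding ordinary_polynomial_le_def polynomial_in_coords_def by blast
  show ?thesis unfolding a by (intro continuous_intros)
qed

text \<open>
  Induction on the set \<open>J\<close> of coordinates that may be nonzero, for all functions
  and degrees at once: Newton's formula in a new direction has the coefficient \<open>n choose
  k\<close>, of degree \<open>k\<close>, at the \<open>k\<close>-th difference, which has
  degree \<open>m - k\<close>. So the total degree stays at most \<open>m\<close>.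
\<close>
lemma polynomial_function_on_lattice:
  fixes F :: "real ^ 'p \<Rightarrow> 'k::real_normed_field"
  assumes "polynomial_function_le m F"
  obtains P :: "real ^ 'p \<Rightarrow> 'k" where "ordinary_polynomial_le m P"
    "\<And>n :: 'p \<Rightarrow> nat. F (\<chi> i. real (n i)) = P (\<chi> i. real (n i))"
proof -
  have "\<exists>P :: real ^ 'p \<Rightarrow> 'k. ordinary_polynomial_le m P \<and>
      (\<forall>n :: 'p \<Rightarrow> nat. F (\<Sum>i\<in>J. real (n i) *\<^sub>R axis i 1) = P (\<chi> i. real (n i)))"
    if "finite J" for J :: "'p set"
    using that assms
  proof (induction J arbitrary: F m rule: finite_induct)
    case empty
    show ?case
      by (rule exI [of _ "\<lambda>_. F 0"])
        (simp add: ordinary_polynomial_le_def polynomial_in_coords_const)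
  next
    case (insert j J)
    let ?D = "\<lambda>k. (diff_op (axis j 1) ^^ k) F"
    have ex: "\<exists>P :: real ^ 'p \<Rightarrow> 'k. ordinary_polynomial_le (m - k) P \<and>
      (\<forall>n :: 'p \<Rightarrow> nat. ?D k (\<Sum>i\<in>J. real (n i) *\<^sub>R axis i 1) = P (\<chi> i. real (n i)))"
      if "k \<le> m" for k
      by (rule insert.IH) (rule polynomial_function_le_funpow_diff_op [OF that insert.prems])
    define P :: "nat \<Rightarrow> real ^ 'p \<Rightarrow> 'k" where "P k = (SOME P. ordinary_polynomial_le (m - k) P \<and>
      (\<forall>n :: 'p \<Rightarrow> nat. ?D k (\<Sum>i\<in>J. real (n i) *\<^sub>R axis i 1) = P (\<chi> i. real (n i))))" for k
    have P: "\<And>k. k \<le> m \<Longrightarrow> ordinary_polynomial_le (m - k) (P k)"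
      "\<And>k n. k \<le> m \<Longrightarrow> ?D k (\<Sum>i\<in>J. real (n i) *\<^sub>R axis i 1) = P k (\<chi> i. real (n i))"
      using someI_ex [OF ex] unfolding P_def by blast+
    define R where "R x = (\<Sum>k\<le>m. poly (binomial_poly k) (of_real (x $ j)) * P k x)" for x
    have "ordinary_polynomial_le m R"
      unfolding R_def ordinary_polynomial_le_def
    proof (intro polynomial_in_coords_sum finite)
      fix k assume "k \<in> {..m}"
      then have "polynomial_in_coords UNIV (\<lambda>k x. x $ k) (k + (m - k))
          (\<lambda>x. poly (binomial_poly k) (of_real (x $ j)) * P k x)"
        using P(1) [of k] degree_binomial_poly [of k, where 'k = 'k]
        unfolding ordinary_polynomial_le_def
        by (intro polynomial_in_coords_mult polynomial_in_coords_poly [where t = "\<lambda>k x. x $ k"]) auto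
      with \<open>k \<in> {..m}\<close> show "polynomial_in_coords UNIV (\<lambda>k x. x $ k) m
          (\<lambda>x. poly (binomial_poly k) (of_real (x $ j)) * P k x)"
        by simp
    qed
    moreover have "F (\<Sum>i\<in>insert j J. real (n i) *\<^sub>R axis i 1) = R (\<chi> i. real (n i))" for n
    proof -
      have "F (\<Sum>i\<in>insert j J. real (n i) *\<^sub>R axis i 1)
          = F ((\<Sum>i\<in>J. real (n i) *\<^sub>R axis i 1) + real (n j) *\<^sub>R axis j 1)"
        using insert.hyps by (simp add: add.commute)
      also have "\<dots> = (\<Sum>k\<le>m. of_nat (n j choose k) * ?D k (\<Sum>i\<in>J. real (n i) *\<^sub>R axis i 1))"
        by (rule Newton_forward_difference [OF insert.prems])
      also have "\<dots> = R (\<chi> i. real (n i))"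
        unfolding R_def by (intro sum.cong refl) (simp add: P(2) poly_binomial_poly)
      finally show ?thesis .
    qed
    ultimately show ?case by blast
  qed
  from this [of UNIV] obtain P :: "real ^ 'p \<Rightarrow> 'k" where P: "ordinary_polynomial_le m P"
    "\<And>n :: 'p \<Rightarrow> nat. F (\<Sum>i\<in>UNIV. real (n i) *\<^sub>R axis i 1) = P (\<chi> i. real (n i))"
    by auto
  have "(\<Sum>i\<in>UNIV. real (n i) *\<^sub>R axis i 1) = (\<chi> i. real (n i))" for n :: "'p \<Rightarrow> nat"
    by (simp add: vec_eq_iff axis_def if_distrib sum.delta cong: if_cong)
  then show ?thesis
    using P by (intro that [of P]) simp_all
qed

section \<open>Boundedness on a set of positive measure\<close>

lemma rational_vector_dense:
  fixes x :: "real ^ 'p"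
  assumes "e > 0"
  obtains a :: "'p \<Rightarrow> int" and N :: nat where "N > 0" "norm (x - (\<chi> i. real_of_int (a i) / real N)) < e"
proof -
  obtain N :: nat where N: "real N > real CARD('p) / e" using reals_Archimedean2 by blast
  moreover have "real CARD('p) / e > 0" using assms by simp
  ultimately have "N > 0" by (metis of_nat_0_less_iff order_less_trans)
  define a where "a i = \<lfloor>real N * (x $ i)\<rfloor>" for i
  have "norm (x - (\<chi> i. real_of_int (a i) / real N)) \<le> (\<Sum>i\<in>UNIV. \<bar>x $ i - real_of_int (a i) / real N\<bar>)"
    using norm_le_l1_cart [of "x - (\<chi> i. real_of_int (a i) / real N)"] by simp
  also have "\<dots> \<le> (\<Sum>i\<in>(UNIV::'p set). 1 / real N)"
  proof (rule sum_mono)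
    fix i
    have "\<bar>real N * (x $ i) - real_of_int (a i)\<bar> \<le> 1" unfolding a_def by linarith
    then have "\<bar>real N * (x $ i) - real_of_int (a i)\<bar> / real N \<le> 1 / real N"
      by (rule divide_right_mono) simp
    moreover have "\<bar>x $ i - real_of_int (a i) / real N\<bar> = \<bar>(real N * (x $ i) - real_of_int (a i)) / real N\<bar>"
      using \<open>N > 0\<close> by (simp add: diff_divide_distrib)
    ultimately show "\<bar>x $ i - real_of_int (a i) / real N\<bar> \<le> 1 / real N" by (simp add: abs_divide)
  qed
  also have "\<dots> < e" using N \<open>N > 0\<close> assms by (simp add: field_simps)
  finally show ?thesis using \<open>N > 0\<close> that by blast
qed

text \<open>
  The progression from \<open>x = a / N\<close> towards a lattice point \<open>b\<close> with
  \<open>b \<ge> \<bar>a\<bar>\<close> meets the lattice at every index \<open>1 + N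
  k\<close>, namely in \<open>b + k (N b - a)\<close>, and these points have natural
  coordinates.
\<close>
lemma polynomial_on_lines_vanishing_rational:
  fixes D :: "real ^ 'p \<Rightarrow> 'k::real_normed_field"
  assumes D: "polynomial_on_lines m D" and zero: "\<And>n :: 'p \<Rightarrow> nat. D (\<chi> i. real (n i)) = 0"
    and N: "N > 0"
  shows "D (\<chi> i. real_of_int (a i) / real N) = 0"
proof -
  define x where "x = (\<chi> i. real_of_int (a i) / real N)"
  define b where "b = (\<chi> i. real_of_int \<bar>a i\<bar>)"
  have "D (x + real (1 + N * k) *\<^sub>R (b - x)) = 0" for k
  proof -
    define n where "n i = nat (\<bar>a i\<bar> + int k * (int N * \<bar>a i\<bar> - a i))" for i
    have "a i \<le> int N * \<bar>a i\<bar>" for i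
    proof -
      have "1 * \<bar>a i\<bar> \<le> int N * \<bar>a i\<bar>" using N by (intro mult_right_mono) auto
      then show ?thesis by simp
    qed
    then have "real (n i) = real_of_int (\<bar>a i\<bar> + int k * (int N * \<bar>a i\<bar> - a i))" for i
      unfolding n_def by (subst of_nat_nat) auto
    then have "x + real (1 + N * k) *\<^sub>R (b - x) = (\<chi> i. real (n i))"
      using N by (simp add: vec_eq_iff x_def b_def field_simps)
    then show ?thesis by (simp add: zero)
  qed
  then have "range (\<lambda>k. 1 + N * k) \<subseteq> {n. D (x + real n *\<^sub>R (b - x)) = 0}" by blast
  moreover have "infinite (range (\<lambda>k. 1 + N * k))"
    using N by (intro range_inj_infinite) (simp add: inj_def)
  ultimately have "D (x + real 0 *\<^sub>R (b - x)) = 0"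
    by (intro polynomial_on_lines_eq_0 [OF D]) (use finite_subset in blast)
  then show ?thesis by (simp add: x_def)
qed

text \<open>
  Any \<open>y\<close> lies on a progression that starts at \<open>c\<close> with steps so
  small that its first \<open>m + 1\<close> terms stay in the ball.
\<close>
lemma polynomial_on_lines_vanishing_ball:
  fixes D :: "'a::real_normed_vector \<Rightarrow> 'k::real_normed_field"
  assumes D: "polynomial_on_lines m D" and r: "r > 0" and zero: "\<And>x. x \<in> ball c r \<Longrightarrow> D x = 0"
  shows "D y = 0"
proof -
  obtain N :: nat where N: "real N > real m * norm (y - c) / r" using reals_Archimedean2 by blast
  define L where "L = Suc N"
  define h where "h = (1 / real L) *\<^sub>R (y - c)"
  obtain Q where Q: "degree Q \<le> m" "\<And>n::nat. D (c + real n *\<^sub>R h) = poly Q (of_nat n)"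
    using polynomial_on_linesE [OF D, of c h] by blast
  have "poly Q (of_nat n) = 0" if "n \<le> m" for n
  proof -
    have "real m * norm (y - c) < real L * r"
      using N r by (simp add: L_def field_simps)
    moreover have "real n * norm (y - c) \<le> real m * norm (y - c)"
      using that by (simp add: mult_right_mono)
    ultimately have "real n * norm (y - c) / real L < r"
      by (simp add: L_def field_simps)
    then have "norm (real n *\<^sub>R h) < r" by (simp add: h_def)
    then have "c + real n *\<^sub>R h \<in> ball c r" by (simp add: dist_norm)
    then show ?thesis using zero Q(2) by metis
  qed
  moreover have "card (of_nat ` {..m} :: 'k set) = m + 1"
    by (subst card_image) (auto simp: inj_on_def)
  ultimately have "Q = 0"
    using Q(1) by (intro poly_eqI_degree [of "of_nat ` {..m}"]) auto
  then have "D (c + real L *\<^sub>R h) = 0" by (simp add: Q)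
  then show ?thesis by (simp add: h_def L_def del: of_nat_Suc)
qed

text \<open>
  The polynomial \<open>P\<close> that interpolates \<open>F\<close> on the lattice differs
  from \<open>F\<close> by a function \<open>D\<close> that vanishes at the rational points
  and is bounded on a ball. For a small step \<open>h = x - q\<close> with \<open>q\<close>
  rational, \<open>D (q + n h)\<close> is a polynomial in \<open>n\<close> with a zero at 0
  that stays bounded for many \<open>n\<close>, so its value \<open>D x\<close> at 1 is small.
\<close>
lemma bounded_polynomial_function_is_ordinary:
  fixes F :: "real ^ 'p \<Rightarrow> 'k::real_normed_field"
  assumes F: "polynomial_function_le m F"
    and A: "A \<in> sets lebesgue" "emeasure lebesgue A > 0" "bounded (F ` A)"
  shows "ordinary_polynomial_le m F"
proof -
  note FL = polynomial_on_lines_polynomial_function [OF F]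
  obtain P :: "real ^ 'p \<Rightarrow> 'k" where P: "ordinary_polynomial_le m P"
    and FP: "\<And>n :: 'p \<Rightarrow> nat. F (\<chi> i. real (n i)) = P (\<chi> i. real (n i))"
    using polynomial_function_on_lattice [OF F] by blast
  define D where "D x = F x - P x" for x
  have D: "polynomial_on_lines m D"
    unfolding D_def
    by (intro polynomial_on_lines_diff FL polynomial_on_lines_ordinary_polynomial P)
  have rat: "D (\<chi> i. real_of_int (a i) / real N) = 0" if "N > 0" for a :: "'p \<Rightarrow> int" and N
    by (rule polynomial_on_lines_vanishing_rational [OF D _ that]) (simp add: D_def FP)
  obtain M where M: "\<And>x. x \<in> A \<Longrightarrow> norm (F x) \<le> M"
    using A(3) unfolding bounded_iff by auto
  obtain C where C: "\<forall>x h M. (\<forall>k\<in>{1..m+1}. norm (F (x + real k *\<^sub>R h)) \<le> M) \<longrightarrow> norm (F x) \<le> M * C"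
    using polynomial_on_lines_bounded_extrapolation [OF FL] ..
  obtain c r where r: "r > 0" and prog: "\<And>x. x \<in> ball c r \<Longrightarrow> \<exists>h. \<forall>k\<in>{1..m+1}. x + real k *\<^sub>R h \<in> A"
    using positive_measure_contains_progressions [OF A(1,2)] by metis
  have "bounded (P ` cball c r)"
    by (intro compact_imp_bounded compact_continuous_image continuous_on_ordinary_polynomial [OF P]) simp
  then obtain B where B: "\<And>x. x \<in> cball c r \<Longrightarrow> norm (P x) \<le> B"
    unfolding bounded_iff by (auto simp del: mem_cball)
  have bound: "norm (D x) \<le> M * C + B" if x: "x \<in> ball c r" for x
  proof -
    obtain h where "\<forall>k\<in>{1..m+1}. x + real k *\<^sub>R h \<in> A" using prog [OF x] by blast
    then have "norm (F x) \<le> M * C" using M by (intro C [rule_format, of x h]) blast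
    moreover have "norm (P x) \<le> B" using x by (intro B) simp
    ultimately show ?thesis
      unfolding D_def using norm_triangle_ineq4 [of "F x" "P x"] by linarith
  qed
  have ball: "D x = 0" if x: "x \<in> ball c (r / 2)" for x
  proof -
    have "norm (D x) \<le> e" if e: "e > 0" for e
    proof -
      obtain N :: nat where N: "\<forall>Q :: 'k poly. degree Q \<le> m \<longrightarrow> poly Q 0 = 0 \<longrightarrow>
          (\<forall>j\<le>m. norm (poly Q (of_nat (j * N))) \<le> M * C + B) \<longrightarrow> norm (poly Q 1) < e"
        using bounded_poly_small_near_root [OF e] by blast
      \<comment> \<open>A step shorter than \<open>s\<close> keeps the terms with index up to \<open>m N\<close> within \<open>r / 2\<close> of \<open>x\<close>.\<close>
      define s where "s = r / (2 * (real (m * N) + 1))"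
      have "s > 0" using r by (simp add: s_def add_nonneg_pos)
      then obtain a :: "'p \<Rightarrow> int" and L where L: "L > 0"
        "norm (x - (\<chi> i. real_of_int (a i) / real L)) < s"
        using rational_vector_dense by blast
      define q where "q = (\<chi> i. real_of_int (a i) / real L)"
      define h where "h = x - q"
      have h: "norm h < s" using L by (simp add: h_def q_def)
      obtain Q where Q: "degree Q \<le> m" "\<And>n::nat. D (q + real n *\<^sub>R h) = poly Q (of_nat n)"
        using polynomial_on_linesE [OF D, of q h] by blast
      have "poly Q 0 = 0" using Q(2) [of 0] rat [OF L(1), of a] by (simp add: q_def)
      moreover have "norm (poly Q (of_nat (j * N))) \<le> M * C + B" if "j \<le> m" for j
      proof -
        have "norm ((real (j * N) - 1) *\<^sub>R h) \<le> (real (m * N) + 1) * s"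
          unfolding norm_scaleR
        proof (intro mult_mono)
          have "real (j * N) \<le> real (m * N)" using that by (simp add: mult_right_mono)
          then show "\<bar>real (j * N) - 1\<bar> \<le> real (m * N) + 1" by linarith
        qed (use h in auto)
        also have "\<dots> = r / 2"
        proof -
          have "w * (r / (2 * w)) = r / 2" if "w > 0" for w :: real
            using that by simp
          moreover have "real (m * N) + 1 > 0" by (rule add_nonneg_pos) simp_all
          ultimately show ?thesis unfolding s_def by blast
        qed
        finally have "dist c (x + (real (j * N) - 1) *\<^sub>R h) < r"
          using x norm_triangle_ineq4 [of "c - x" "(real (j * N) - 1) *\<^sub>R h"]
          by (simp add: dist_norm algebra_simps)
        moreover have "x + (real (j * N) - 1) *\<^sub>R h = q + real (j * N) *\<^sub>R h"
          by (simp add: h_def algebra_simps)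
        ultimately show ?thesis
          using bound [of "q + real (j * N) *\<^sub>R h"] Q(2) [of "j * N"] by (metis mem_ball)
      qed
      ultimately have "norm (poly Q 1) < e" using N Q(1) by blast
      moreover have "D x = poly Q 1" using Q(2) [of 1] by (simp add: h_def)
      ultimately show ?thesis by simp
    qed
    then have "norm (D x) \<le> 0" by (rule field_le_epsilon [where y = 0, simplified])
    then show ?thesis by simp
  qed
  have "D x = 0" for x
    by (rule polynomial_on_lines_vanishing_ball [OF D, where r = "r / 2" and c = c])
      (simp_all add: r ball del: mem_ball)
  then have "F = P" by (simp add: D_def fun_eq_iff)
  with P show ?thesis by simp
qed

section \<open>Functions of all but one of the vectors\<close>

text \<open>
  The vanishing difference of \<open>F\<close> at 0 with increments \<open>x 1, \<dots>, x
  (m+1)\<close> expresses the value at the full sum by values at partial sums. The partial sum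
  over a proper subset \<open>S\<close> becomes part of \<open>G i\<close> for the least index
  \<open>i\<close> not in \<open>S\<close>.
\<close>
lemma ordinary_polynomial_splitting:
  fixes F :: "real ^ 'p \<Rightarrow> 'k::real_normed_field"
  assumes F: "polynomial_function_le m F" and ord: "ordinary_polynomial_le m F"
  obtains G :: "nat \<Rightarrow> (nat \<Rightarrow> real ^ 'p) \<Rightarrow> 'k"
  where "\<And>i. i \<in> {1..m+1} \<Longrightarrow> ordinary_polynomial_tuple_le m m (G i)"
    "\<And>x. F (\<Sum>i=1..m+1. x i) = (\<Sum>i=1..m+1. G i (omit m i x))"
proof -
  define U where "U = {1..m+1}"
  define W where "W = Pow U - {U}"
  define \<iota> where "\<iota> S = Min (U - S)" for S
  define \<sigma> where "\<sigma> i j = (if j < i then j else j - 1)" for i j :: nat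
  define G where "G i y = (\<Sum>S\<in>{S \<in> W. \<iota> S = i}.
      - ((-1) ^ (m + 1 + card S)) * F (\<Sum>j\<in>S. y (\<sigma> i j)))" for i y
  have finite_W: "finite W" by (simp add: W_def U_def)
  have \<iota>: "\<iota> S \<in> U" "\<iota> S \<notin> S" "S \<subseteq> U" if "S \<in> W" for S
  proof -
    have "Min (U - S) \<in> U - S" using that by (intro Min_in) (auto simp: W_def U_def)
    then show "\<iota> S \<in> U" "\<iota> S \<notin> S" by (auto simp: \<iota>_def)
    show "S \<subseteq> U" using that by (auto simp: W_def)
  qed
  show ?thesis
  proof (rule that)
    fix i assume i: "i \<in> {1..m+1}"
    show "ordinary_polynomial_tuple_le m m (G i)"
      unfolding ordinary_polynomial_tuple_le_def G_def
    proof (intro polynomial_in_coords_sum)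
      fix S assume "S \<in> {S \<in> W. \<iota> S = i}"
      then have S: "i \<notin> S" "S \<subseteq> {1..m+1}" using \<iota> by (auto simp: U_def)
      have "\<sigma> i j \<in> {1..m}" if "j \<in> S" for j
      proof -
        have "j \<noteq> i" "j \<in> {1..m+1}" using that S by auto
        then show ?thesis using i by (auto simp: \<sigma>_def)
      qed
      then have "polynomial_in_coords ({1..m} \<times> UNIV) (\<lambda>(j, k) y. y j $ k) 1
          (\<lambda>y. of_real (y (\<sigma> i j) $ k) :: 'k)" if "j \<in> S" for j and k :: 'p
        using polynomial_in_coords_coord [of "{1..m} \<times> (UNIV::'p set)" "(\<sigma> i j, k)" "\<lambda>(j, k) y. y j $ k"] that
        by simp
      then have "polynomial_in_coords ({1..m} \<times> UNIV) (\<lambda>(j, k) y. y j $ k) 1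
          (\<lambda>y. of_real ((\<Sum>j\<in>S. y (\<sigma> i j)) $ k) :: 'k)" for k :: 'p
        unfolding sum_component of_real_sum by (intro polynomial_in_coords_sum) auto
      then have "polynomial_in_coords ({1..m} \<times> UNIV) (\<lambda>(j, k) y. y j $ k) (0 + m)
          (\<lambda>y. - ((-1) ^ (m + 1 + card S)) * F (\<Sum>j\<in>S. y (\<sigma> i j)))"
        by (intro polynomial_in_coords_mult polynomial_in_coords_const
            ordinary_polynomial_compose [OF ord, where u = "\<lambda>y. \<Sum>j\<in>S. y (\<sigma> i j)"]) auto
      then show "polynomial_in_coords ({1..m} \<times> UNIV) (\<lambda>(j, k) y. y j $ k) m
          (\<lambda>y. - ((-1) ^ (m + 1 + card S)) * F (\<Sum>j\<in>S. y (\<sigma> i j)))"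
        by simp
    qed simp
  next
    fix x :: "nat \<Rightarrow> real ^ 'p"
    let ?h = "\<lambda>S. (-1) ^ (m + 1 + card S) * F (\<Sum>j\<in>S. x j)"
    have "0 = foldr diff_op (map x [1..<Suc (m+1)]) F 0"
      using F by (simp add: polynomial_function_le_def del: upt_Suc)
    also have "\<dots> = sum ?h (Pow U)"
      by (simp only: foldr_diff_op_expand U_def add_0)
    also have "\<dots> = ?h U + sum ?h W"
      unfolding W_def by (rule sum.remove) (auto simp: U_def)
    also have "?h U = F (\<Sum>i=1..m+1. x i)"
      by (simp add: U_def flip: mult_2)
    finally have "F (\<Sum>i=1..m+1. x i) = (\<Sum>S\<in>W. - ?h S)"
      by (simp add: sum_negf eq_neg_iff_add_eq_0)
    also have "\<dots> = (\<Sum>i\<in>U. \<Sum>S\<in>{S \<in> W. \<iota> S = i}. - ?h S)"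
      by (rule sum.group [symmetric]) (use finite_W \<iota> in \<open>auto simp: U_def\<close>)
    also have "\<dots> = (\<Sum>i\<in>U. G i (omit m i x))"
      unfolding G_def
    proof (intro sum.cong refl)
      fix i S assume "i \<in> U" and "S \<in> {S \<in> W. \<iota> S = i}"
      then have S: "i \<notin> S" "S \<subseteq> {1..m+1}" "i \<in> {1..m+1}" using \<iota> by (auto simp: U_def)
      have "omit m i x (\<sigma> i j) = x j" if "j \<in> S" for j
      proof -
        have "j \<noteq> i" "j \<in> {1..m+1}" using that S by auto
        then show ?thesis using S(3) by (auto simp: \<sigma>_def omit_def)
      qed
      then show "- ?h S = - ((-1) ^ (m + 1 + card S)) * F (\<Sum>j\<in>S. omit m i x (\<sigma> i j))"
        by simp
    qed
    finally show "F (\<Sum>i=1..m+1. x i) = (\<Sum>i=1..m+1. G i (omit m i x))" by (simp add: U_def)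
  qed
qed

text \<open>
  A section of \<open>omit\<close>: the entry \<open>c\<close> becomes the new
  \<open>i\<close>-th one.
\<close>
definition insert_at :: "nat \<Rightarrow> 'a \<Rightarrow> (nat \<Rightarrow> 'a) \<Rightarrow> (nat \<Rightarrow> 'a)" where
  "insert_at i c y = (\<lambda>l. if l < i then y l else if l = i then c else y (l - 1))"

lemma omit_insert_at:
  assumes "y \<in> extensional {1..m}"
  shows "omit m i (insert_at i c y) = y"
  using assms by (auto simp: omit_def insert_at_def extensional_def fun_eq_iff)

lemma insert_at_omit:
  assumes "j \<in> {1..m}" "l \<in> {1..m}" "l \<noteq> j"
  shows "insert_at j c (omit (m - 1) j y) l = y l"
  using assms by (auto simp: omit_def insert_at_def)

text \<open>
  Put \<open>x i = c\<close>. Solving the equation for the \<open>i\<close>-th term, each of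
  the other terms omits a further vector besides the constant one.
\<close>
lemma annihilating_family_decomposes:
  fixes d :: "nat \<Rightarrow> (nat \<Rightarrow> 'a) \<Rightarrow> 'b::ab_group_add"
  assumes zero: "\<And>x. (\<forall>i\<in>{1..m+1}. x i \<in> P) \<Longrightarrow> (\<Sum>i=1..m+1. d i (omit m i x)) = 0"
    and c: "c \<in> P" and i: "i \<in> {1..m+1}"
  shows "\<exists>r. \<forall>y \<in> {1..m} \<rightarrow>\<^sub>E P. d i y = (\<Sum>j=1..m. r j (omit (m - 1) j y))"
proof -
  define \<sigma> where "\<sigma> j = (if j < i then j else Suc j)" for j
  define r where "r j z = - d (\<sigma> j) (omit m (\<sigma> j) (insert_at i c (insert_at j c z)))" for j z
  have bij: "bij_betw \<sigma> {1..m} ({1..m+1} - {i})"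
    by (rule bij_betw_byWitness [where f' = "\<lambda>l. if l < i then l else l - 1"])
      (use i in \<open>auto simp: \<sigma>_def\<close>)
  have "d i y = (\<Sum>j=1..m. r j (omit (m - 1) j y))" if y: "y \<in> {1..m} \<rightarrow>\<^sub>E P" for y
  proof -
    define x where "x = insert_at i c y"
    have "x l \<in> P" if "l \<in> {1..m+1}" for l
    proof -
      have "l < i \<Longrightarrow> l \<in> {1..m}" "l > i \<Longrightarrow> l - 1 \<in> {1..m}" using that i by auto
      then show ?thesis using y c by (auto simp: x_def insert_at_def)
    qed
    then have "0 = (\<Sum>l\<in>{1..m+1}. d l (omit m l x))" by (intro zero [symmetric]) blast
    also have "\<dots> = d i (omit m i x) + (\<Sum>l\<in>{1..m+1} - {i}. d l (omit m l x))"
      using i by (intro sum.remove) auto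
    also have "(\<Sum>l\<in>{1..m+1} - {i}. d l (omit m l x)) = (\<Sum>j=1..m. d (\<sigma> j) (omit m (\<sigma> j) x))"
      by (rule sum.reindex_bij_betw [OF bij, symmetric])
    also have "\<dots> = (\<Sum>j=1..m. - r j (omit (m - 1) j y))"
    proof (rule sum.cong [OF refl])
      fix j assume j: "j \<in> {1..m}"
      let ?Y = "insert_at j c (omit (m - 1) j y)"
      have "x l = insert_at i c ?Y l" if "l \<in> {1..m+1}" "l \<noteq> \<sigma> j" for l
      proof -
        have "?Y l = y l" if "l < i"
          using that \<open>l \<in> _\<close> \<open>l \<noteq> \<sigma> j\<close> i by (intro insert_at_omit j) (auto simp: \<sigma>_def split: if_splits)
        moreover have "?Y (l - 1) = y (l - 1)" if "l > i"
          using that \<open>l \<in> _\<close> \<open>l \<noteq> \<sigma> j\<close> i by (intro insert_at_omit j) (auto simp: \<sigma>_def split: if_splits)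
        ultimately show ?thesis
          unfolding x_def insert_at_def [of i] by auto
      qed
      then have "omit m (\<sigma> j) x = omit m (\<sigma> j) (insert_at i c ?Y)"
        unfolding omit_def by (intro restrict_ext) auto
      then show "d (\<sigma> j) (omit m (\<sigma> j) x) = - r j (omit (m - 1) j y)"
        by (simp add: r_def)
    qed
    also have "omit m i x = y"
      unfolding x_def using y by (intro omit_insert_at) (auto simp: PiE_def)
    finally show ?thesis by (simp add: sum_negf)
  qed
  then show ?thesis by blast
qed

section \<open>The representation of solutions\<close>

theorem mainTheorem4:
  fixes f :: "real ^ 'p \<Rightarrow> 'k::real_normed_field"
    and g :: "nat \<Rightarrow> (nat \<Rightarrow> real ^ 'p) \<Rightarrow> 'k"
    and m :: nat
  assumes "m \<ge> 1"
    and "\<And>x. (\<forall>i\<in>{1..m+1}. x i \<in> pos_orthant) \<Longrightarrow>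
           f (\<Sum>i=1..m+1. x i) = (\<Sum>i=1..m+1. g i (omit m i x))"
  shows "(\<exists>!F. polynomial_function_le m F \<and> (\<forall>x\<in>pos_orthant. F x = f x)) \<and>
    (\<forall>A. A \<subseteq> pos_orthant \<and> A \<in> sets lebesgue \<and> emeasure lebesgue A > 0 \<and> bounded (f ` A) \<longrightarrow>
      (\<exists>!F. ordinary_polynomial_le m F \<and> (\<forall>x\<in>pos_orthant. F x = f x)) \<and>
      (\<exists>G :: nat \<Rightarrow> (nat \<Rightarrow> real ^ 'p) \<Rightarrow> 'k.
        (\<forall>i\<in>{1..m+1}. ordinary_polynomial_tuple_le m m (G i)) \<and>
        (\<forall>x. (\<forall>i\<in>{1..m+1}. x i \<in> pos_orthant) \<longrightarrow>
           f (\<Sum>i=1..m+1. x i) = (\<Sum>i=1..m+1. G i (omit m i x))) \<and>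
        (\<forall>i\<in>{1..m+1}. \<exists>r :: nat \<Rightarrow> (nat \<Rightarrow> real ^ 'p) \<Rightarrow> 'k.
           \<forall>y \<in> {1..m} \<rightarrow>\<^sub>E pos_orthant.
             g i y = G i y + (\<Sum>j=1..m. r j (omit (m - 1) j y)))))"
proof -
  obtain F where F: "polynomial_function_le m F" and Ff: "\<And>x. x \<in> pos_orthant \<Longrightarrow> F x = f x"
    using polynomial_extension [of m f g] assms(2) by metis
  have unique: "E = F" if "polynomial_on_lines m E" "\<forall>x\<in>pos_orthant. E x = f x" for E
  proof
    fix x
    have "E x - F x = 0"
      by (rule polynomial_on_lines_vanishing_orthant [of m "\<lambda>x. E x - F x"])
        (use that Ff F in \<open>auto intro: polynomial_on_lines_diff polynomial_on_lines_polynomial_function\<close>)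
    then show "E x = F x" by simp
  qed
  have "\<exists>!F. polynomial_function_le m F \<and> (\<forall>x\<in>pos_orthant. F x = f x)"
    using F Ff unique polynomial_on_lines_polynomial_function by (intro ex1I [of _ F]) blast+
  moreover have "(\<exists>!F. ordinary_polynomial_le m F \<and> (\<forall>x\<in>pos_orthant. F x = f x)) \<and>
      (\<exists>G :: nat \<Rightarrow> (nat \<Rightarrow> real ^ 'p) \<Rightarrow> 'k.
        (\<forall>i\<in>{1..m+1}. ordinary_polynomial_tuple_le m m (G i)) \<and>
        (\<forall>x. (\<forall>i\<in>{1..m+1}. x i \<in> pos_orthant) \<longrightarrow>
           f (\<Sum>i=1..m+1. x i) = (\<Sum>i=1..m+1. G i (omit m i x))) \<and>
        (\<forall>i\<in>{1..m+1}. \<exists>r :: nat \<Rightarrow> (nat \<Rightarrow> real ^ 'p) \<Rightarrow> 'k.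
           \<forall>y \<in> {1..m} \<rightarrow>\<^sub>E pos_orthant.
             g i y = G i y + (\<Sum>j=1..m. r j (omit (m - 1) j y))))"
    if A: "A \<subseteq> pos_orthant \<and> A \<in> sets lebesgue \<and> emeasure lebesgue A > 0 \<and> bounded (f ` A)" for A
  proof (rule conjI)
    have "F ` A = f ` A" using A Ff by (intro image_cong) auto
    then have ord: "ordinary_polynomial_le m F"
      using A by (intro bounded_polynomial_function_is_ordinary [OF F, of A]) auto
    then show "\<exists>!F. ordinary_polynomial_le m F \<and> (\<forall>x\<in>pos_orthant. F x = f x)"
      using Ff unique polynomial_on_lines_ordinary_polynomial by (intro ex1I [of _ F]) blast+
    obtain G :: "nat \<Rightarrow> (nat \<Rightarrow> real ^ 'p) \<Rightarrow> 'k"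
      where G: "\<And>i. i \<in> {1..m+1} \<Longrightarrow> ordinary_polynomial_tuple_le m m (G i)"
        and FG: "\<And>x. F (\<Sum>i=1..m+1. x i) = (\<Sum>i=1..m+1. G i (omit m i x))"
      using ordinary_polynomial_splitting [OF F ord] by blast
    have fG: "f (\<Sum>i=1..m+1. x i) = (\<Sum>i=1..m+1. G i (omit m i x))"
      if x: "\<forall>i\<in>{1..m+1}. x i \<in> pos_orthant" for x
    proof -
      have "(\<Sum>i=1..m+1. x i) \<in> pos_orthant"
        using x by (auto simp: pos_orthant_def sum_component simp del: sum.cl_ivl_Suc intro!: sum_pos)
      then show ?thesis using Ff FG by metis
    qed
    have "(\<Sum>i=1..m+1. g i (omit m i x) - G i (omit m i x)) = 0"
      if "\<forall>i\<in>{1..m+1}. x i \<in> pos_orthant" for x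
      using fG [OF that] assms(2) [OF that] by (simp only: sum_subtractf diff_self)
    moreover have "(1 :: real ^ 'p) \<in> pos_orthant" by (simp add: pos_orthant_def)
    ultimately have dec: "\<exists>r. \<forall>y \<in> {1..m} \<rightarrow>\<^sub>E pos_orthant. g i y - G i y = (\<Sum>j=1..m. r j (omit (m - 1) j y))"
      if "i \<in> {1..m+1}" for i
      using that by (rule annihilating_family_decomposes [where d = "\<lambda>i y. g i y - G i y"])
    have dec': "\<exists>r. \<forall>y \<in> {1..m} \<rightarrow>\<^sub>E pos_orthant. g i y = G i y + (\<Sum>j=1..m. r j (omit (m - 1) j y))"
      if "i \<in> {1..m+1}" for i
      using dec [OF that] by (simp only: diff_eq_eq add.commute)
    show "\<exists>G :: nat \<Rightarrow> (nat \<Rightarrow> real ^ 'p) \<Rightarrow> 'k.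
        (\<forall>i\<in>{1..m+1}. ordinary_polynomial_tuple_le m m (G i)) \<and>
        (\<forall>x. (\<forall>i\<in>{1..m+1}. x i \<in> pos_orthant) \<longrightarrow>
           f (\<Sum>i=1..m+1. x i) = (\<Sum>i=1..m+1. G i (omit m i x))) \<and>
        (\<forall>i\<in>{1..m+1}. \<exists>r :: nat \<Rightarrow> (nat \<Rightarrow> real ^ 'p) \<Rightarrow> 'k.
           \<forall>y \<in> {1..m} \<rightarrow>\<^sub>E pos_orthant.
             g i y = G i y + (\<Sum>j=1..m. r j (omit (m - 1) j y)))"
      by (rule exI [of _ G], intro conjI ballI allI impI) (rule G fG dec', assumption)+
  qed
  ultimately show ?thesis by blast
qed

end
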